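(* Let $d=2$ and $T>0$. There exist initial data $u_0\in L^\infty(\mathbb T^2)$ with $\operatorname{div}u_0=0$ and an augmented measure-valued solution $\nu$ of the incompressible Euler system on $(0,T)\times\mathbb T^2$ with initial data $u_0$ that does not fulfill the Jensen condition $$\langle S_\#\nu,f\rangle\ge Q_{\mathcal A_E}f(\langle S_\#\nu,\operatorname{id}\rangle)\quad\text{for all }f\in C(\mathbb R^N)$$ on a set of positive measure (i.e. on a subset of $(0,T)\times\mathbb T^2$ of positive measure the inequality fails for some $f\in C(\mathbb R^N)$).
   Context: A Young measure on $(0,T)\times\mathbb T^d$ is a weakly*-measurable map into probability measures on some $\mathbb R^m$; $\langle\nu,f\rangle(t,x)=\int f\,d\nu_{(t,x)}$; pushforwards are pointwise. Augmented measure-valued solution of the incompressible Euler system with initial data $u_0\in L^1(\mathbb T^d)$: a Young measure $\mu$ with values in $\mathcal P(\mathbb R^d\times\mathbb R)$ (variables $(u,P)$) such that $\langle\mu,|u|^2\rangle\in L^\infty((0,T)\times\mathbb T^d)$ and $$\int_0^T\!\!\int_{\mathbb T^d}\partial_t\varphi\cdot\langle\mu,u\rangle+\nabla\varphi:\langle\mu,u\otimes u\rangle+\langle\mu,P\rangle\operatorname{div}\varphi\,dx\,dt=-\int_{\mathbb T^d}\varphi(0)\cdot u_0\,dx,\qquad\int_{\mathbb T^d}\nabla\psi\cdot\langle\mu,u\rangle\,dx=0\ \text{ (for a.e. }t)$$ for all $\varphi\in C_c^\infty([0,T)\times\mathbb T^d,\mathbb R^d)$, $\psi\in C^\infty(\mathbb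 T^d)$. Lift: $S(u,P)=\left(1,u,u\otimes u-\frac{|u|^2}d\mathbb E_d,P+\frac{|u|^2}d\right)\in\mathbb R\times\mathbb R^d\times S_0^d\times\mathbb R\cong\mathbb R^N$, where $\mathbb E_d$ is the identity matrix, $S_0^d$ = symmetric trace-free $d\times d$ matrices, $N=\dim(\mathbb R\times\mathbb R^d\times S_0^d\times\mathbb R)$. Here $d=2$. Operator and envelope: $\mathcal A_E(\rho,m,M,Q)=(\partial_tm+\operatorname{div}M+\nabla Q,\ \partial_t\rho+\operatorname{div}m)$ in the $d+1$ variables $(t,x)$, and $$Q_{\mathcal A_E}f(z)=\inf\left\{⨍_{\mathbb T^{d+1}}f(z+\varphi(y))\,dy:\ \varphi\in C^\infty(\mathbb T^{d+1},\mathbb R^N),\ \mathcal A_E\varphi=0,\ ⨍_{\mathbb T^{d+1}}\varphi\,dy=0\right\},$$ where ⨍ denotes the mean value integral. *)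

theory Defs
  imports "HOL-Probability.Probability"
begin

section \<open>Functions on the torus\<close>

text \<open>The torus is \<open>\<real>\<^sup>n/\<int>\<^sup>n\<close>: functions on it are functions on the whole space that are 1-periodic in
  every coordinate, and integrals over it are integrals over the unit cube, which has measure one.\<close>

definition torus_periodic :: "('a::euclidean_space \<Rightarrow> 'b) \<Rightarrow> bool" where
  "torus_periodic f \<longleftrightarrow> (\<forall>b\<in>Basis. \<forall>x. f (x + b) = f x)"

abbreviation torus_cell :: "'a::euclidean_space set" where
  "torus_cell \<equiv> cbox 0 One"

definition torus_integral ::
  "('a::euclidean_space \<Rightarrow> 'b::{banach, second_countable_topology}) \<Rightarrow> 'b" where
  "torus_integral f = set_lebesgue_integral lebesgue torus_cell f"

abbreviation spacetime :: "real \<Rightarrow> (real \<times> (real ^ 'd)) set" where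
  "spacetime T \<equiv> {0<..<T} \<times> torus_cell"

primrec C_k :: "nat \<Rightarrow> ('a::euclidean_space \<Rightarrow> 'b::real_normed_vector) \<Rightarrow> bool" where
  "C_k 0 f \<longleftrightarrow> continuous_on UNIV f"
| "C_k (Suc k) f \<longleftrightarrow> (\<forall>x. f differentiable (at x)) \<and>
     (\<forall>b\<in>Basis. C_k k (\<lambda>x. frechet_derivative f (at x) b))"

definition C_inf :: "('a::euclidean_space \<Rightarrow> 'b::real_normed_vector) \<Rightarrow> bool" where
  "C_inf f \<longleftrightarrow> (\<forall>k. C_k k f)"

definition gradient :: "(real ^ 'd \<Rightarrow> real) \<Rightarrow> real ^ 'd \<Rightarrow> real ^ 'd" where
  "gradient \<psi> x = (\<chi> i. frechet_derivative \<psi> (at x) (axis i 1))"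

definition d_t :: "(real \<times> (real ^ 'd) \<Rightarrow> 'b::real_normed_vector) \<Rightarrow> real \<times> (real ^ 'd) \<Rightarrow> 'b" where
  "d_t \<phi> z = frechet_derivative \<phi> (at z) (1, 0)"

definition d_x :: "'d \<Rightarrow> (real \<times> (real ^ 'd) \<Rightarrow> 'b::real_normed_vector) \<Rightarrow> real \<times> (real ^ 'd) \<Rightarrow> 'b" where
  "d_x j \<phi> z = frechet_derivative \<phi> (at z) (0, axis j 1)"

definition jacobian_x :: "(real \<times> (real ^ 'd) \<Rightarrow> real ^ 'd) \<Rightarrow> real \<times> (real ^ 'd) \<Rightarrow> real ^ 'd ^ 'd" where
  "jacobian_x \<phi> z = (\<chi> i j. d_x j \<phi> z $ i)"

definition div_x :: "(real \<times> (real ^ 'd) \<Rightarrow> real ^ 'd) \<Rightarrow> real \<times> (real ^ 'd) \<Rightarrow> real" where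
  "div_x \<phi> z = (\<Sum>j\<in>UNIV. d_x j \<phi> z $ j)"

text \<open>\<open>C\<^sub>c\<^sup>\<infinity>([0,T) \<times> \<T>\<^sup>d, \<real>\<^sup>d)\<close>: smooth up to \<open>t = 0\<close> (and extended smoothly to negative times), so that no
  boundary condition is imposed there, but vanishing near \<open>t = T\<close>.\<close>

definition test_field :: "real \<Rightarrow> (real \<times> (real ^ 'd) \<Rightarrow> real ^ 'd) \<Rightarrow> bool" where
  "test_field T \<phi> \<longleftrightarrow> C_inf \<phi> \<and> (\<forall>t. torus_periodic (\<lambda>x. \<phi> (t, x))) \<and>
     (\<exists>T'<T. \<forall>t\<ge>T'. \<forall>x. \<phi> (t, x) = 0)"

definition L1_torus :: "(real ^ 'd \<Rightarrow> real ^ 'd) \<Rightarrow> bool" where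
  "L1_torus u \<longleftrightarrow> torus_periodic u \<and> set_integrable lebesgue torus_cell u"

definition Linf_torus :: "(real ^ 'd \<Rightarrow> real ^ 'd) \<Rightarrow> bool" where
  "Linf_torus u \<longleftrightarrow> torus_periodic u \<and> u \<in> borel_measurable lebesgue \<and>
     (\<exists>C. AE x in lebesgue. norm (u x) \<le> C)"

text \<open>\<open>div u = 0\<close> in the sense of distributions on the torus.\<close>

definition weakly_div_free :: "(real ^ 'd \<Rightarrow> real ^ 'd) \<Rightarrow> bool" where
  "weakly_div_free u \<longleftrightarrow>
     (\<forall>\<psi>. C_inf \<psi> \<and> torus_periodic \<psi> \<longrightarrow> torus_integral (\<lambda>x. gradient \<psi> x \<bullet> u x) = 0)"


section \<open>Young measures\<close>

text \<open>Weak* measurability is tested against \<open>C\<^sub>0\<close>, the predual of the finite signed measures.\<close>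

definition young_measure ::
  "real \<Rightarrow> (real \<times> (real ^ 'd) \<Rightarrow> ('v::euclidean_space) measure) \<Rightarrow> bool" where
  "young_measure T \<nu> \<longleftrightarrow>
     (\<forall>t\<in>{0<..<T}. torus_periodic (\<lambda>x. \<nu> (t, x))) \<and>
     (\<forall>z\<in>{0<..<T} \<times> UNIV. prob_space (\<nu> z) \<and> sets (\<nu> z) = sets borel) \<and>
     (\<forall>f :: 'v \<Rightarrow> real. continuous_on UNIV f \<and> (f \<longlongrightarrow> 0) at_infinity \<longrightarrow>
        (\<lambda>z. integral\<^sup>L (\<nu> z) f) \<in> borel_measurable (lebesgue_on ({0<..<T} \<times> UNIV)))"

definition pairing ::
  "('z \<Rightarrow> 'v measure) \<Rightarrow> ('v \<Rightarrow> 'b::{banach, second_countable_topology}) \<Rightarrow> 'z \<Rightarrow> 'b" where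
  "pairing \<nu> f z = integral\<^sup>L (\<nu> z) f"

definition outer :: "real ^ 'd \<Rightarrow> real ^ 'd \<Rightarrow> real ^ 'd ^ 'd" where
  "outer u v = (\<chi> i j. u $ i * v $ j)"

text \<open>Since Bochner integrals of non-integrable functions are \<open>0\<close> by convention, the existence of the
  integrals involving \<open>P\<close> is required explicitly; that of the others follows from the bound on
  \<open>\<langle>\<mu>,|u|\<^sup>2\<rangle>\<close>, which is an integral with values in \<open>[0,\<infinity>]\<close>. The inner product of matrices is the Frobenius
  product.\<close>

definition augmented_mv_solution ::
  "real \<Rightarrow> (real ^ 'd \<Rightarrow> real ^ 'd) \<Rightarrow> (real \<times> (real ^ 'd) \<Rightarrow> ((real ^ 'd) \<times> real) measure) \<Rightarrow> bool" where
  "augmented_mv_solution T u0 \<mu> \<longleftrightarrow>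
     L1_torus u0 \<and>
     young_measure T \<mu> \<and>
     (\<exists>C::real. AE z in lebesgue. z \<in> spacetime T \<longrightarrow>
        (\<integral>\<^sup>+ (u, P). ennreal ((norm u)\<^sup>2) \<partial>\<mu> z) \<le> ennreal C) \<and>
     (AE z in lebesgue. z \<in> spacetime T \<longrightarrow> integrable (\<mu> z) (\<lambda>(u, P). P)) \<and>
     (\<forall>\<phi>. test_field T \<phi> \<longrightarrow>
        (let I = (\<lambda>z. d_t \<phi> z \<bullet> pairing \<mu> (\<lambda>(u, P). u) z
                    + jacobian_x \<phi> z \<bullet> pairing \<mu> (\<lambda>(u, P). outer u u) z
                    + pairing \<mu> (\<lambda>(u, P). P) z * div_x \<phi> z)
         in set_integrable lebesgue (spacetime T) I \<and>
            set_lebesgue_integral lebesgue (spacetime T) I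
              = - torus_integral (\<lambda>x. \<phi> (0, x) \<bullet> u0 x))) \<and>
     (\<forall>\<psi>. C_inf \<psi> \<and> torus_periodic \<psi> \<longrightarrow>
        (AE t in lebesgue. t \<in> {0<..<T} \<longrightarrow>
           torus_integral (\<lambda>x. gradient \<psi> x \<bullet> pairing \<mu> (\<lambda>(u, P). u) (t, x)) = 0))"


section \<open>Lift, Euler operator and envelope\<close>

text \<open>\<open>\<real> \<times> \<real>\<^sup>d \<times> S\<^sub>0\<^sup>d \<times> \<real> \<cong> \<real>\<^sup>N\<close> is the linear subspace \<open>state_space\<close> of the type \<open>'d state\<close>, whose third
  component ranges over all matrices. Functions on \<open>\<real>\<^sup>N\<close> only matter on that subspace.\<close>

type_synonym 'd state = "real \<times> (real ^ 'd) \<times> (real ^ 'd ^ 'd) \<times> real"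

definition state_space :: "('d::finite) state set" where
  "state_space = {(\<rho>, m, M, Q). transpose M = M \<and> trace M = 0}"

definition lift :: "(real ^ 'd) \<times> real \<Rightarrow> ('d::finite) state" where
  "lift = (\<lambda>(u, P). (1, u, outer u u - ((norm u)\<^sup>2 / real CARD('d)) *\<^sub>R mat 1,
                    P + (norm u)\<^sup>2 / real CARD('d)))"

lemma lift_in_state_space: "lift v \<in> state_space"
  by (cases v)
     (auto simp: lift_def state_space_def outer_def transpose_def trace_def mat_def vec_eq_iff
        power2_norm_eq_inner inner_vec_def sum_subtractf mult.commute)

lemma lift_measurable:
  "lift \<in> borel \<rightarrow>\<^sub>M restrict_space borel (state_space :: ('d::finite) state set)"
proof (rule measurable_restrict_space2)
  have "continuous_on UNIV (lift :: _ \<Rightarrow> 'd state)"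
    unfolding lift_def outer_def case_prod_beta by (intro continuous_intros) auto
  then show "(lift :: _ \<Rightarrow> 'd state) \<in> borel_measurable borel"
    by (rule borel_measurable_continuous_onI)
qed (simp add: lift_in_state_space)

definition lifted ::
  "(real \<times> (real ^ 'd) \<Rightarrow> ((real ^ 'd) \<times> real) measure) \<Rightarrow> real \<times> (real ^ 'd) \<Rightarrow> ('d::finite) state measure" where
  "lifted \<nu> z = distr (\<nu> z) (restrict_space borel state_space) lift"

definition euler_op :: "(real \<times> (real ^ 'd) \<Rightarrow> ('d::finite) state) \<Rightarrow> real \<times> (real ^ 'd) \<Rightarrow> (real ^ 'd) \<times> real" where
  "euler_op w z =
     (let \<rho> = (\<lambda>y. case w y of (r, m, M, Q) \<Rightarrow> r);
          m = (\<lambda>y. case w y of (r, m, M, Q) \<Rightarrow> m);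
          M = (\<lambda>y. case w y of (r, m, M, Q) \<Rightarrow> M);
          Q = (\<lambda>y. case w y of (r, m, M, Q) \<Rightarrow> Q)
      in (d_t m z + (\<chi> i. \<Sum>j\<in>UNIV. d_x j M z $ i $ j) + (\<chi> i. d_x i Q z),
          d_t \<rho> z + div_x m z))"

text \<open>The infimum may be \<open>-\<infinity>\<close>, hence the values in \<open>ereal\<close>.\<close>

definition Q_envelope :: "(('d::finite) state \<Rightarrow> real) \<Rightarrow> 'd state \<Rightarrow> ereal" where
  "Q_envelope f z =
     Inf {ereal (torus_integral (\<lambda>y. f (z + \<phi> y))) | \<phi> :: real \<times> (real ^ 'd) \<Rightarrow> 'd state.
            C_inf \<phi> \<and> torus_periodic \<phi> \<and> range \<phi> \<subseteq> state_space \<and>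
            (\<forall>y. euler_op \<phi> y = (0, 0)) \<and> torus_integral \<phi> = 0}"

text \<open>The Jensen condition for a measure-valued map \<open>\<sigma>\<close> at a point. A continuous \<open>f\<close> need not be
  \<open>\<sigma> z\<close>-integrable; the inequality is only required where its left-hand side is a well-defined real number,
  so that every failure of the condition is a genuine one.\<close>

definition jensen_at :: "('z \<Rightarrow> ('d::finite) state measure) \<Rightarrow> 'z \<Rightarrow> bool" where
  "jensen_at \<sigma> z \<longleftrightarrow>
     (\<forall>f. continuous_on state_space f \<and> integrable (\<sigma> z) f \<longrightarrow>
        ereal (pairing \<sigma> f z) \<ge> Q_envelope f (pairing \<sigma> (\<lambda>v. v) z))"

end

theory Submission
  imports Defs
begin

text \<open>The solution is homogeneous: \<open>\<nu>\<close> is the average of two Dirac masses with opposite velocities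
  \<open>\<plusminus>e\<^sub>1\<close> and opposite pressures \<open>\<plusminus>1\<close>, so \<open>u\<^sub>0 = 0\<close>. Euler states correspond to matrices
  \<open>X = ((\<rho>, m), (m, M + Q))\<close> with divergence-free rows in space-time, and the wave cone consists of the singular
  ones. Half the difference \<open>D\<close> of the two lifted states is nonsingular, and the quadratic form
  \<open>2 |X D\<^sup>-\<^sup>1|\<^sup>2 - (tr X D\<^sup>-\<^sup>1)\<^sup>2\<close> is nonnegative on the wave cone, because \<open>(tr Y)\<^sup>2 \<le> 2 |Y|\<^sup>2\<close> if \<open>rank Y \<le> 2\<close>,
  but equals \<open>-3\<close> at \<open>D\<close>. By Fourier analysis the form is quasiconvex for the Euler operator, hence lies below its
  envelope, whereas its average over the two states is smaller by 3 than its value at the barycentre.\<close>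

section \<open>Integration over a period\<close>

text \<open>The box \<open>cbox u (v + h *\<^sub>R b)\<close> is cut once at height
  \<open>u \<bullet> b + h\<close> and once at height \<open>v \<bullet> b\<close>; the two slabs of
  thickness \<open>h\<close> that are cut off are translates of each other by \<open>b\<close>. Only
  the side along \<open>b\<close> has length one; the others are free, which later admits a time
  interval of length \<open>T\<close>.\<close>

lemma integral_shift_one_period:
  fixes f :: "'a::euclidean_space \<Rightarrow> 'b::euclidean_space"
  assumes f: "continuous_on UNIV f" and b: "b \<in> Basis" and per: "\<And>x. f (x + b) = f x"
    and uv: "v \<bullet> b = u \<bullet> b + 1" and h: "0 \<le> h" "h \<le> 1"
  shows "integral (cbox u v) (\<lambda>x. f (x + h *\<^sub>R b)) = integral (cbox u v) f"
proof -
  have int: "f integrable_on cbox p q" for p q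
    by (rule integrable_continuous) (rule continuous_on_subset[OF f], simp)
  have bb: "b \<bullet> b = 1" "\<And>i. i \<in> Basis \<Longrightarrow> i \<noteq> b \<Longrightarrow> b \<bullet> i = 0"
    using b by (auto simp: inner_Basis)
  define W where "W = cbox u (v + h *\<^sub>R b)"
  define L where "L = W \<inter> {x. x \<bullet> b \<le> u \<bullet> b + h}"
  define L' where "L' = cbox u (\<Sum>i\<in>Basis. (if i = b then u \<bullet> b + h else v \<bullet> i) *\<^sub>R i)"
  have mem: "x \<in> cbox p q \<longleftrightarrow> p \<bullet> b \<le> x \<bullet> b \<and> x \<bullet> b \<le> q \<bullet> b \<and> 
      (\<forall>i\<in>Basis - {b}. p \<bullet> i \<le> x \<bullet> i \<and> x \<bullet> i \<le> q \<bullet> i)" for x p q :: 'a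
    using b by (auto simp: mem_box)
  have L: "L = L'"
    using uv h b bb unfolding L_def W_def L'_def by (auto simp: mem inner_left_distrib)
  have 1: "W \<inter> {x. x \<bullet> b \<ge> u \<bullet> b + h} = cbox (u + h *\<^sub>R b) (v + h *\<^sub>R b)"
    using uv h bb unfolding W_def by (auto simp: mem inner_left_distrib)
  have 2: "W \<inter> {x. x \<bullet> b \<le> v \<bullet> b} = cbox u v"
    using uv h bb unfolding W_def by (auto simp: mem inner_left_distrib)
  \<comment> \<open>The top slab is the bottom slab \<open>L'\<close> moved by
    \<open>b\<close>.\<close>
  have 3: "W \<inter> {x. x \<bullet> b \<ge> v \<bullet> b} = cbox (u + b) ((\<Sum>i\<in>Basis. (if i = b then u \<bullet> b + h else v \<bullet> i) *\<^sub>R i) + b)"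
    using uv h b bb unfolding W_def by (auto simp: mem inner_left_distrib)
  have "integral (cbox (u + b) ((\<Sum>i\<in>Basis. (if i = b then u \<bullet> b + h else v \<bullet> i) *\<^sub>R i) + b)) f
      = integral L' (f \<circ> (+) b)"
    unfolding L'_def by (rule integral_shift_cbox_plus[symmetric])
  also have "f \<circ> (+) b = f"
    by (auto simp: per add.commute)
  finally have 4: "integral (W \<inter> {x. x \<bullet> b \<ge> v \<bullet> b}) f = integral L f"
    by (simp add: 3 L)
  have "integral L f + integral (W \<inter> {x. x \<bullet> b \<ge> u \<bullet> b + h}) f = integral W f"
    unfolding L_def W_def by (rule integral_split[OF int b, symmetric])
  moreover have "integral (cbox u v) f + integral (W \<inter> {x. x \<bullet> b \<ge> v \<bullet> b}) f = integral W f"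
    unfolding 2[symmetric] W_def by (rule integral_split[OF int b, symmetric])
  ultimately have "integral (cbox (u + h *\<^sub>R b) (v + h *\<^sub>R b)) f = integral (cbox u v) f"
    unfolding 1 4 by (metis add.commute add_left_cancel)
  then show ?thesis
    by (simp add: integral_shift_cbox_plus[symmetric] o_def add.commute)
qed

text \<open>This takes the place of integration by parts: the integral of
  \<open>f (x + h *\<^sub>R b)\<close> is constant in \<open>h\<close>, and differentiating under
  the integral sign at \<open>h = 0\<close> gives the claim.\<close>

lemma integral_periodic_derivative:
  fixes f :: "'a::euclidean_space \<Rightarrow> 'b::euclidean_space"
  assumes f: "\<And>x. (f has_derivative f' x) (at x)" and f': "continuous_on UNIV (\<lambda>x. f' x b)"
    and b: "b \<in> Basis" and per: "\<And>x. f (x + b) = f x" and uv: "v \<bullet> b = u \<bullet> b + 1"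
  shows "integral (cbox u v) (\<lambda>x. f' x b) = 0"
proof -
  have cf: "continuous_on UNIV f"
    using f has_derivative_continuous by (intro continuous_at_imp_continuous_on) blast
  define g where "g h = integral (cbox u v) (\<lambda>x. f (x + h *\<^sub>R b))" for h
  \<comment> \<open>Shifts are controlled for \<open>0 \<le> h \<le> 1\<close>, hence the one-sided
    derivative at \<open>0\<close>.\<close>
  have "(g has_vector_derivative integral (cbox u v) (\<lambda>x. f' (x + 0 *\<^sub>R b) b)) (at 0 within {0..1})"
    unfolding g_def
  proof (rule leibniz_rule_vector_derivative[where fx = "\<lambda>h x. f' (x + h *\<^sub>R b) b"])
    fix h :: real and x
    have "((\<lambda>h. f (x + h *\<^sub>R b)) has_derivative (\<lambda>r. f' (x + h *\<^sub>R b) (r *\<^sub>R b))) (at h)"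
      by (rule has_derivative_compose[OF _ f]) (auto intro!: derivative_eq_intros)
    moreover have "f' (x + h *\<^sub>R b) (r *\<^sub>R b) = r *\<^sub>R f' (x + h *\<^sub>R b) b" for r
      using f[of "x + h *\<^sub>R b"] has_derivative_bounded_linear linear_simps(5) by blast
    ultimately have "((\<lambda>h. f (x + h *\<^sub>R b)) has_derivative (\<lambda>r. r *\<^sub>R f' (x + h *\<^sub>R b) b)) (at h)"
      by simp
    then show "((\<lambda>h. f (x + h *\<^sub>R b)) has_vector_derivative f' (x + h *\<^sub>R b) b) (at h within {0..1})"
      unfolding has_vector_derivative_def by (rule has_derivative_at_withinI)
  next
    fix h :: real
    show "(\<lambda>x. f (x + h *\<^sub>R b)) integrable_on cbox u v"
      by (intro integrable_continuous continuous_on_compose2[OF cf]) (auto intro!: continuous_intros)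
  next
    show "continuous_on ({0..1} \<times> cbox u v) (\<lambda>(h, x). f' (x + h *\<^sub>R b) b)"
      unfolding case_prod_beta by (intro continuous_on_compose2[OF f']) (auto intro!: continuous_intros)
  qed auto
  moreover have "(g has_vector_derivative 0) (at 0 within {0..1})"
  proof (rule has_vector_derivative_transform[of _ _ g "\<lambda>_. integral (cbox u v) f"])
    fix h :: real assume "h \<in> {0..1}"
    then show "g h = integral (cbox u v) f"
      unfolding g_def by (intro integral_shift_one_period[OF cf b per uv]) auto
  qed auto
  ultimately show ?thesis
    using vector_derivative_unique_within[of 0 "{0..1::real}"] by (simp add: trivial_limit_within)
qed

section \<open>Fourier coefficients on the torus\<close>

definition int_lattice :: "'a::euclidean_space set" where
  "int_lattice = {k. \<forall>b\<in>Basis. k \<bullet> b \<in> \<int>}"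

definition character :: "'a::euclidean_space \<Rightarrow> 'a \<Rightarrow> complex" where
  "character k x = cis (2 * pi * (k \<bullet> x))"

definition trig_polynomial :: "('a::euclidean_space \<Rightarrow> complex) \<Rightarrow> bool" where
  "trig_polynomial f \<longleftrightarrow>
     (\<exists>K a. finite K \<and> K \<subseteq> int_lattice \<and> f = (\<lambda>x. \<Sum>k\<in>K. a k * character k x))"

lemma character_add: "character (k + l) x = character k x * character l x"
  by (simp add: character_def inner_add_left ring_distribs cis_mult)

lemma cnj_character: "cnj (character k x) = character (- k) x"
  by (simp add: character_def cis_cnj)

lemma character_zero [simp]: "character 0 x = 1"
  by (simp add: character_def)

lemma continuous_on_character [continuous_intros]: "continuous_on A (character k)"
  unfolding character_def cis_conv_exp by (intro continuous_intros)

lemma int_lattice_add: "k \<in> int_lattice \<Longrightarrow> l \<in> int_lattice \<Longrightarrow> k + l \<in> int_lattice"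
  and int_lattice_diff: "k \<in> int_lattice \<Longrightarrow> l \<in> int_lattice \<Longrightarrow> k - l \<in> int_lattice"
  and int_lattice_zero: "0 \<in> int_lattice"
  and int_lattice_minus: "k \<in> int_lattice \<Longrightarrow> - k \<in> int_lattice"
  and int_lattice_Basis: "b \<in> Basis \<Longrightarrow> b \<in> int_lattice"
  by (auto simp: int_lattice_def inner_simps inner_Basis)

lemma character_periodic:
  assumes "k \<in> int_lattice" "b \<in> Basis"
  shows "character k (x + b) = character k x"
proof -
  obtain n :: int where n: "k \<bullet> b = n"
    using assms by (auto simp: int_lattice_def elim: Ints_cases)
  show ?thesis
    by (simp add: character_def inner_add_right ring_distribs n flip: cis_mult)
qed

text \<open>A shift by half a wavelength, along an axis not orthogonal to \<open>k\<close>, reverses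
  the sign of the character but preserves its integral.\<close>

lemma integral_character:
  fixes k :: "'a::euclidean_space"
  assumes k: "k \<in> int_lattice"
  shows "integral torus_cell (character k) = (if k = 0 then 1 else 0)"
proof (cases "k = 0")
  case True
  have "character 0 = (\<lambda>x::'a. 1)"
    by (simp add: fun_eq_iff)
  then show ?thesis
    using True by simp
next
  case False
  then obtain b where b: "b \<in> Basis" "k \<bullet> b \<noteq> 0"
    using euclidean_all_zero_iff by blast
  obtain n :: int where n: "k \<bullet> b = n"
    using k b by (auto simp: int_lattice_def elim: Ints_cases)
  \<comment> \<open>Half a wavelength in direction \<open>b\<close>; since
    \<open>k \<bullet> b\<close> is a nonzero integer, \<open>h \<le> 1/2\<close>.\<close>
  define h where "h = 1 / (2 * \<bar>k \<bullet> b\<bar>)"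
  have n1: "1 \<le> \<bar>k \<bullet> b\<bar>"
    using b n by auto
  have "cis (2 * pi * (h * (k \<bullet> b))) = -1"
  proof (cases "k \<bullet> b > 0")
    case True
    then have "2 * pi * (h * (k \<bullet> b)) = pi" by (simp add: h_def field_simps)
    then show ?thesis by (simp only: cis_pi)
  next
    case False
    then have "2 * pi * (h * (k \<bullet> b)) = - pi" using b by (simp add: h_def field_simps)
    then show ?thesis by (simp only:) (simp add: complex_eq_iff)
  qed
  then have "character k (x + h *\<^sub>R b) = - character k x" for x
    by (simp add: character_def inner_add_right ring_distribs flip: cis_mult)
  moreover have "integral torus_cell (\<lambda>x. character k (x + h *\<^sub>R b)) = integral torus_cell (character k)"
    using n1 b(1) character_periodic[OF k b(1)]
    by (intro integral_shift_one_period continuous_on_character) (auto simp: h_def divide_simps)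
  ultimately have "- integral torus_cell (character k) = integral torus_cell (character k)"
    by simp
  then show ?thesis
    using False by (simp add: complex_eq_iff)
qed

section \<open>The algebra of trigonometric polynomials\<close>

lemma trig_polynomial_add:
  assumes "trig_polynomial f" "trig_polynomial g"
  shows "trig_polynomial (\<lambda>x. f x + g x)"
proof -
  obtain K a where K: "finite K" "K \<subseteq> int_lattice" and f: "f = (\<lambda>x. \<Sum>k\<in>K. a k * character k x)"
    using assms(1) unfolding trig_polynomial_def by blast
  obtain L c where L: "finite L" "L \<subseteq> int_lattice" and g: "g = (\<lambda>x. \<Sum>k\<in>L. c k * character k x)"
    using assms(2) unfolding trig_polynomial_def by blast
  define d where "d k = (if k \<in> K then a k else 0) + (if k \<in> L then c k else 0)" for k
  have "f x + g x = (\<Sum>k\<in>K \<union> L. d k * character k x)" for x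
  proof -
    have "f x = (\<Sum>k\<in>K \<union> L. (if k \<in> K then a k else 0) * character k x)"
      unfolding f using K L by (intro sum.mono_neutral_cong_left) auto
    moreover have "g x = (\<Sum>k\<in>K \<union> L. (if k \<in> L then c k else 0) * character k x)"
      unfolding g using K L by (intro sum.mono_neutral_cong_left) auto
    ultimately show ?thesis
      by (simp add: d_def ring_distribs sum.distrib)
  qed
  then show ?thesis
    unfolding trig_polynomial_def using K L by (intro exI[of _ "K \<union> L"] exI[of _ d]) auto
qed

lemma trig_polynomial_character: 
  assumes "k \<in> int_lattice"
  shows "trig_polynomial (\<lambda>x. c * character k x)"
  unfolding trig_polynomial_def using assms by (intro exI[of _ "{k}"] exI[of _ "\<lambda>_. c"]) auto

lemma trig_polynomial_const: "trig_polynomial (\<lambda>x. c)"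
  using trig_polynomial_character[OF int_lattice_zero, of c] by simp

lemma trig_polynomial_sum:
  "(\<And>i. i \<in> I \<Longrightarrow> trig_polynomial (f i)) \<Longrightarrow> trig_polynomial (\<lambda>x. \<Sum>i\<in>I. f i x)"
  by (induction I rule: infinite_finite_induct) (auto intro: trig_polynomial_add trig_polynomial_const)

lemma trig_polynomial_mult:
  assumes "trig_polynomial f" "trig_polynomial g"
  shows "trig_polynomial (\<lambda>x. f x * g x)"
proof -
  obtain K a where K: "finite K" "K \<subseteq> int_lattice" and f: "f = (\<lambda>x. \<Sum>k\<in>K. a k * character k x)"
    using assms(1) unfolding trig_polynomial_def by blast
  obtain L c where L: "finite L" "L \<subseteq> int_lattice" and g: "g = (\<lambda>x. \<Sum>k\<in>L. c k * character k x)"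
    using assms(2) unfolding trig_polynomial_def by blast
  have "(\<lambda>x. f x * g x) = (\<lambda>x. \<Sum>k\<in>K. \<Sum>l\<in>L. (a k * c l) * character (k + l) x)"
    unfolding f g sum_product by (simp add: character_add mult_ac)
  \<comment> \<open>Different pairs may share the frequency \<open>k + l\<close>, so the product is
    treated as a sum of single characters, whose like terms are merged by
    \<open>trig_polynomial_sum\<close>.\<close>
  moreover have "trig_polynomial (\<lambda>x. \<Sum>k\<in>K. \<Sum>l\<in>L. (a k * c l) * character (k + l) x)"
    using K L by (intro trig_polynomial_sum trig_polynomial_character int_lattice_add) auto
  ultimately show ?thesis
    by simp
qed

lemma trig_polynomial_cos_sin:
  assumes "k \<in> int_lattice"
  shows "trig_polynomial (\<lambda>x. complex_of_real (cos (2 * pi * (k \<bullet> x))))"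
    and "trig_polynomial (\<lambda>x. complex_of_real (sin (2 * pi * (k \<bullet> x))))"
proof -
  have "(\<lambda>x. complex_of_real (cos (2 * pi * (k \<bullet> x)))) =
      (\<lambda>x. (1/2) * character k x + (1/2) * character (- k) x)"
    by (auto simp: character_def complex_eq_iff)
  then show "trig_polynomial (\<lambda>x. complex_of_real (cos (2 * pi * (k \<bullet> x))))"
    using assms by (simp only:) (intro trig_polynomial_add trig_polynomial_character int_lattice_minus)
  have "(\<lambda>x. complex_of_real (sin (2 * pi * (k \<bullet> x)))) =
      (\<lambda>x. (- \<i>/2) * character k x + (\<i>/2) * character (- k) x)"
    by (auto simp: character_def complex_eq_iff)
  then show "trig_polynomial (\<lambda>x. complex_of_real (sin (2 * pi * (k \<bullet> x))))"
    using assms by (simp only:) (intro trig_polynomial_add trig_polynomial_character int_lattice_minus)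
qed

section \<open>Lattice periodicity and uniform approximation\<close>

lemma torus_periodic_add_int:
  assumes g: "torus_periodic g" and b: "b \<in> Basis"
  shows "g (x + of_int n *\<^sub>R b) = g x"
proof -
  have nat: "g (x + of_nat m *\<^sub>R b) = g x" for m x
  proof (induction m)
    case (Suc m)
    have "x + of_nat (Suc m) *\<^sub>R b = (x + of_nat m *\<^sub>R b) + b"
      by (simp add: algebra_simps)
    then show ?case
      using Suc g b unfolding torus_periodic_def by metis
  qed simp
  show ?thesis
  proof (cases n)
    case (nonneg m)
    then show ?thesis using nat by simp
  next
    case (neg m)
    then have "x + of_int n *\<^sub>R b = x - of_nat (Suc m) *\<^sub>R b"
      by (simp del: of_nat_Suc)
    then show ?thesis using nat[of "x - of_nat (Suc m) *\<^sub>R b" "Suc m"] by simp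
  qed
qed

lemma torus_periodic_add_lattice:
  fixes g :: "'a::euclidean_space \<Rightarrow> 'b"
  assumes g: "torus_periodic g" and k: "k \<in> int_lattice"
  shows "g (x + k) = g x"
proof -
  have "g (x + (\<Sum>b\<in>B. (k \<bullet> b) *\<^sub>R b)) = g x" if "finite B" "B \<subseteq> Basis" for B
    using that
  proof (induction B)
    case (insert b B)
    obtain n :: int where n: "k \<bullet> b = n"
      using k insert.prems by (force simp: int_lattice_def elim: Ints_cases)
    have "g (x + (\<Sum>b\<in>insert b B. (k \<bullet> b) *\<^sub>R b)) = g ((x + (\<Sum>b\<in>B. (k \<bullet> b) *\<^sub>R b)) + of_int n *\<^sub>R b)"
      using insert n by (simp add: algebra_simps)
    also have "\<dots> = g x"
      using insert torus_periodic_add_int[OF g] by auto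
    finally show ?case .
  qed simp
  from this[of Basis] show ?thesis
    by (simp add: euclidean_representation)
qed

text \<open>Equal cosines and sines force every coordinate difference to be an integer. Hence a
  periodic function factors through the embedding of the torus used below.\<close>

lemma torus_periodic_eqI:
  fixes g :: "'a::euclidean_space \<Rightarrow> 'b"
  assumes g: "torus_periodic g"
    and "\<And>b. b \<in> Basis \<Longrightarrow> cos (2 * pi * (x \<bullet> b)) = cos (2 * pi * (y \<bullet> b))"
    and "\<And>b. b \<in> Basis \<Longrightarrow> sin (2 * pi * (x \<bullet> b)) = sin (2 * pi * (y \<bullet> b))"
  shows "g x = g y"
proof -
  have "x - y \<in> int_lattice"
    unfolding int_lattice_def mem_Collect_eq
  proof
    fix b :: 'a assume "b \<in> Basis"
    then obtain n :: int where "2 * pi * (x \<bullet> b) = 2 * pi * (y \<bullet> b) + 2 * pi * n"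
      using assms sin_cos_eq_iff by blast
    then have "2 * pi * (x \<bullet> b - y \<bullet> b) = 2 * pi * n"
      by (simp add: algebra_simps)
    then have "x \<bullet> b - y \<bullet> b = n"
      by simp
    then show "(x - y) \<bullet> b \<in> \<int>"
      by (simp add: inner_diff_left)
  qed
  from torus_periodic_add_lattice[OF g this, of y] show ?thesis
    by simp
qed

text \<open>The torus is embedded into Euclidean space by the map with components
  \<open>cos (2 \<pi> x\<^sub>b)\<close> and \<open>sin (2 \<pi> x\<^sub>b)\<close>; polynomials on the image pull back to trigonometric polynomials.\<close>

lemma trig_polynomial_approx:
  fixes g :: "'a::euclidean_space \<Rightarrow> real"
  assumes cont: "continuous_on UNIV g" and per: "torus_periodic g" and e: "e > 0"
  obtains f where "trig_polynomial f" "\<And>x. x \<in> torus_cell \<Longrightarrow> norm (complex_of_real (g x) - f x) < e"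
proof -
  define E :: "'a \<Rightarrow> 'a \<times> 'a" where
    "E x = ((\<Sum>b\<in>Basis. cos (2 * pi * (x \<bullet> b)) *\<^sub>R b), (\<Sum>b\<in>Basis. sin (2 * pi * (x \<bullet> b)) *\<^sub>R b))" for x
  have contE: "continuous_on A E" for A
    unfolding E_def by (intro continuous_intros)
  have Eeq: "g x = g y" if "E x = E y" for x y
  proof (rule torus_periodic_eqI[OF per])
    fix b :: 'a assume b: "b \<in> Basis"
    have "fst (E x) \<bullet> b = fst (E y) \<bullet> b" "snd (E x) \<bullet> b = snd (E y) \<bullet> b"
      using that by auto
    then show "cos (2 * pi * (x \<bullet> b)) = cos (2 * pi * (y \<bullet> b))" "sin (2 * pi * (x \<bullet> b)) = sin (2 * pi * (y \<bullet> b))"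
      using b by (simp_all add: E_def)
  qed
  define S where "S = E ` torus_cell"
  \<comment> \<open>\<open>E\<close> identifies opposite faces of the closed cell, so
    \<open>inv_into\<close> picks one of several preimages; by \<open>Eeq\<close> the value of
    \<open>G\<close> does not depend on the choice.\<close>
  define G where "G = g \<circ> inv_into torus_cell E"
  have GE: "G (E x) = g x" if "x \<in> torus_cell" for x
    using that unfolding G_def by (auto intro!: Eeq simp: f_inv_into_f)
  \<comment> \<open>The graph of \<open>G\<close> is the image of the compact cell under the
    continuous map with components \<open>E\<close> and \<open>g\<close>, hence closed; as the
    values lie in a compact set, continuity follows.\<close>
  have "continuous_on S G"
  proof (rule continuous_from_closed_graph)
    show "compact (g ` torus_cell)"
      by (intro compact_continuous_image compact_cbox continuous_on_subset[OF cont]) simp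
    show "G \<in> S \<rightarrow> g ` torus_cell"
      using GE by (auto simp: S_def)
    have "(\<lambda>x. (x, G x)) ` S = (\<lambda>x. (E x, g x)) ` torus_cell"
      using GE by (force simp: S_def)
    also have "compact \<dots>"
      by (intro compact_continuous_image compact_cbox continuous_on_Pair contE continuous_on_subset[OF cont]) simp
    finally show "closed ((\<lambda>x. (x, G x)) ` S)"
      by (rule compact_imp_closed)
  qed
  moreover have "compact S"
    unfolding S_def by (intro compact_continuous_image contE compact_cbox)
  ultimately obtain p where p: "real_polynomial_function p" "\<And>x. x \<in> S \<Longrightarrow> \<bar>G x - p x\<bar> < e"
    using Stone_Weierstrass_real_polynomial_function e by metis
  have "trig_polynomial (\<lambda>x. complex_of_real (p (E x)))"
    using p(1)
  proof (induction p)
    \<comment> \<open>A linear functional of \<open>E x\<close> is a combination of the cosines and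
      sines of the coordinates; the other cases are constants and the algebra operations.\<close>
    case (linear h)
    interpret h: bounded_linear h by fact
    have "h (E x) = (\<Sum>b\<in>Basis. cos (2 * pi * (b \<bullet> x)) * h (b, 0)) + (\<Sum>b\<in>Basis. sin (2 * pi * (b \<bullet> x)) * h (0, b))" for x
    proof -
      have "E x = (\<Sum>b\<in>Basis. cos (2 * pi * (b \<bullet> x)) *\<^sub>R (b, 0)) + (\<Sum>b\<in>Basis. sin (2 * pi * (b \<bullet> x)) *\<^sub>R (0, b))"
        by (simp add: E_def prod_eq_iff fst_sum snd_sum inner_commute)
      then show ?thesis
        by (simp only: h.add h.sum h.scaleR real_scaleR_def)
    qed
    then show ?case
      by (auto intro!: trig_polynomial_add trig_polynomial_sum trig_polynomial_mult trig_polynomial_cos_sin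
          trig_polynomial_const int_lattice_Basis)
  qed (auto intro: trig_polynomial_const trig_polynomial_add trig_polynomial_mult)
  moreover have "norm (complex_of_real (g x) - complex_of_real (p (E x))) < e" if "x \<in> torus_cell" for x
    using p(2)[of "E x"] that GE[OF that] by (simp add: S_def flip: of_real_diff)
  ultimately show ?thesis
    using that by blast
qed

section \<open>Bessel's inequality and one half of Parseval's identity\<close>

definition fourier_coeff :: "('a::euclidean_space \<Rightarrow> complex) \<Rightarrow> 'a \<Rightarrow> complex" where
  "fourier_coeff g k = integral torus_cell (\<lambda>x. g x * cnj (character k x))"

text \<open>Orthonormality of the characters reduces the expanded square to a single sum over
  \<open>K\<close>, in which each term is completed to a square. The choice of the Fourier
  coefficients for \<open>a\<close> yields Bessel's inequality; for arbitrary \<open>a\<close>, the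
  last sum is nonnegative.\<close>

lemma integral_norm_diff_trig_polynomial:
  fixes g :: "'a::euclidean_space \<Rightarrow> complex"
  assumes g: "continuous_on UNIV g" and K: "finite K" "K \<subseteq> int_lattice"
  shows "integral torus_cell (\<lambda>x. (norm (g x - (\<Sum>k\<in>K. a k * character k x)))\<^sup>2) =
    integral torus_cell (\<lambda>x. (norm (g x))\<^sup>2) - (\<Sum>k\<in>K. (norm (fourier_coeff g k))\<^sup>2)
      + (\<Sum>k\<in>K. (norm (fourier_coeff g k - a k))\<^sup>2)"
proof -
  note [continuous_intros] = continuous_on_subset[OF g subset_UNIV]
  have int: "f integrable_on torus_cell" if "continuous_on UNIV f" for f :: "'a \<Rightarrow> complex"
    by (rule integrable_continuous) (rule continuous_on_subset[OF that], simp)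
  have intr: "f integrable_on torus_cell" if "continuous_on UNIV f" for f :: "'a \<Rightarrow> real"
    by (rule integrable_continuous) (rule continuous_on_subset[OF that], simp)
  \<comment> \<open>On \<open>complex\<close> the inner product is the real part of
    \<open>w * cnj z\<close>, so a factor moved across it leaves a conjugate behind.\<close>
  have ii: "w \<bullet> (c * z) = c \<bullet> (w * cnj z)" for w z c :: complex
    by (simp add: inner_complex_def algebra_simps)
  have inner_int: "integral torus_cell (\<lambda>x. c \<bullet> f x) = c \<bullet> integral torus_cell f"
    if "continuous_on UNIV f" for c and f :: "'a \<Rightarrow> complex"
    using integral_linear[OF int[OF that] bounded_linear_inner_right[of c]] by (simp add: o_def)
  have 1: "integral torus_cell (\<lambda>x. g x \<bullet> (a k * character k x)) = a k \<bullet> fourier_coeff g k" for k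
  proof -
    have "integral torus_cell (\<lambda>x. g x \<bullet> (a k * character k x)) =
        integral torus_cell (\<lambda>x. a k \<bullet> (g x * cnj (character k x)))"
      by (intro integral_cong ii)
    then show ?thesis
      unfolding fourier_coeff_def by (subst (asm) inner_int) (auto intro!: continuous_intros)
  qed
  have 2: "integral torus_cell (\<lambda>x. (a k * character k x) \<bullet> (a l * character l x))
      = (if k = l then (norm (a k))\<^sup>2 else 0)" if "k \<in> K" "l \<in> K" for k l
  proof -
    have "(a k * character k x) \<bullet> (a l * character l x) = (a l * cnj (a k)) \<bullet> character (k - l) x" for x
      using character_add[of k "- l" x]
      by (simp add: inner_complex_def flip: cnj_character) (simp add: algebra_simps)
    then have "integral torus_cell (\<lambda>x. (a k * character k x) \<bullet> (a l * character l x)) 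
        = (a l * cnj (a k)) \<bullet> integral torus_cell (character (k - l))"
      by (simp add: inner_int continuous_on_character)
    also have "integral torus_cell (character (k - l)) = (if k - l = 0 then 1 else 0)"
      using that K by (intro integral_character int_lattice_diff) auto
    finally show ?thesis
      by (cases "k = l") (simp_all add: complex_norm_square[symmetric] inner_complex_def del: of_real_power)
  qed
  define P where "P x = (\<Sum>k\<in>K. a k * character k x)" for x
  have P [continuous_intros]: "continuous_on A P" for A
    unfolding P_def by (intro continuous_intros)
  have "integral torus_cell (\<lambda>x. (norm (g x - P x))\<^sup>2) =
    integral torus_cell (\<lambda>x. (norm (g x))\<^sup>2 - 2 * (g x \<bullet> P x) + P x \<bullet> P x)"
    by (simp add: power2_norm_eq_inner inner_diff inner_commute algebra_simps)
  also have "\<dots> = integral torus_cell (\<lambda>x. (norm (g x))\<^sup>2) - 2 * integral torus_cell (\<lambda>x. g x \<bullet> P x)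
      + integral torus_cell (\<lambda>x. P x \<bullet> P x)"
    by (subst integral_add integral_diff; (intro intr continuous_intros)?; simp)+
  also have "integral torus_cell (\<lambda>x. g x \<bullet> P x) = (\<Sum>k\<in>K. a k \<bullet> fourier_coeff g k)"
    unfolding P_def inner_sum_right using K
    by (subst integral_sum) (auto simp: 1 intro!: intr continuous_intros)
  also have "integral torus_cell (\<lambda>x. P x \<bullet> P x) = (\<Sum>k\<in>K. \<Sum>l\<in>K. if k = l then (norm (a k))\<^sup>2 else 0)"
  proof -
    have "integral torus_cell (\<lambda>x. P x \<bullet> P x) =
        integral torus_cell (\<lambda>x. \<Sum>k\<in>K. \<Sum>l\<in>K. (a k * character k x) \<bullet> (a l * character l x))"
      unfolding P_def inner_sum_right inner_sum_left by (subst sum.swap) (rule refl)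
    also have "\<dots> = (\<Sum>k\<in>K. \<Sum>l\<in>K. integral torus_cell (\<lambda>x. (a k * character k x) \<bullet> (a l * character l x)))"
      using K by (simp add: integral_sum intr continuous_intros)
    finally show ?thesis
      by (simp add: 2 cong: sum.cong)
  qed
  also have "\<dots> = (\<Sum>k\<in>K. (norm (a k))\<^sup>2)"
    using K by simp
  also have "integral torus_cell (\<lambda>x. (norm (g x))\<^sup>2) - 2 * (\<Sum>k\<in>K. a k \<bullet> fourier_coeff g k) + (\<Sum>k\<in>K. (norm (a k))\<^sup>2)
     = integral torus_cell (\<lambda>x. (norm (g x))\<^sup>2) - (\<Sum>k\<in>K. (norm (fourier_coeff g k))\<^sup>2)
      + (\<Sum>k\<in>K. (norm (fourier_coeff g k - a k))\<^sup>2)"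
    by (simp add: power2_norm_eq_inner inner_diff inner_commute algebra_simps sum.distrib sum_subtractf sum_distrib_left)
  finally show ?thesis
    unfolding P_def .
qed

lemma bessel_inequality:
  fixes g :: "'a::euclidean_space \<Rightarrow> complex"
  assumes g: "continuous_on UNIV g" and K: "finite K" "K \<subseteq> int_lattice"
  shows "(\<Sum>k\<in>K. (norm (fourier_coeff g k))\<^sup>2) \<le> integral torus_cell (\<lambda>x. (norm (g x))\<^sup>2)"
proof -
  have "0 \<le> integral torus_cell (\<lambda>x. (norm (g x - (\<Sum>k\<in>K. fourier_coeff g k * character k x)))\<^sup>2)"
    by (intro integral_nonneg integrable_continuous continuous_intros continuous_on_subset[OF g]) auto
  then show ?thesis
    unfolding integral_norm_diff_trig_polynomial[OF assms] by simp
qed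

text \<open>\<open>K\<close> consists of the frequencies of a trigonometric polynomial within
  \<open>sqrt e\<close> of \<open>g\<close> on the cell. The cell has volume one, so the mean square
  error is at most \<open>e\<close>.\<close>

lemma parseval_approx:
  fixes g :: "'a::euclidean_space \<Rightarrow> real"
  assumes g: "continuous_on UNIV g" and per: "torus_periodic g" and e: "e > 0"
  obtains K where "finite K" "K \<subseteq> int_lattice"
    "integral torus_cell (\<lambda>x. (g x)\<^sup>2) \<le> (\<Sum>k\<in>K. (norm (fourier_coeff (\<lambda>x. complex_of_real (g x)) k))\<^sup>2) + e"
proof -
  obtain f where "trig_polynomial f"
    and f: "\<And>x. x \<in> torus_cell \<Longrightarrow> norm (complex_of_real (g x) - f x) < sqrt e"
    using trig_polynomial_approx[OF g per, of "sqrt e"] e by auto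
  then obtain K a where K: "finite K" "K \<subseteq> int_lattice" and fK: "f = (\<lambda>x. \<Sum>k\<in>K. a k * character k x)"
    unfolding trig_polynomial_def by blast
  have g': "continuous_on UNIV (\<lambda>x. complex_of_real (g x))"
    by (intro continuous_intros g)
  have "integral torus_cell (\<lambda>x. (norm (complex_of_real (g x) - f x))\<^sup>2) \<le> integral torus_cell (\<lambda>x::'a. e)"
  proof (rule integral_le)
    fix x :: 'a assume "x \<in> torus_cell"
    then have "(norm (complex_of_real (g x) - f x))\<^sup>2 \<le> (sqrt e)\<^sup>2"
      using f by (intro power_mono) (auto intro: less_imp_le)
    then show "(norm (complex_of_real (g x) - f x))\<^sup>2 \<le> e"
      using e by simp
  qed (auto simp: fK intro!: integrable_continuous continuous_intros continuous_on_subset[OF g])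
  then have "integral torus_cell (\<lambda>x. (norm (complex_of_real (g x)))\<^sup>2) 
     \<le> (\<Sum>k\<in>K. (norm (fourier_coeff (\<lambda>x. complex_of_real (g x)) k))\<^sup>2) + e"
    unfolding fK integral_norm_diff_trig_polynomial[OF g' K]
    using sum_nonneg[of K "\<lambda>k. (norm (fourier_coeff (\<lambda>x. complex_of_real (g x)) k - a k))\<^sup>2"] by simp
  then show ?thesis
    using K that by simp
qed

section \<open>Divergence-free fields\<close>

text \<open>On the hyperplane orthogonal to \<open>k\<close> the trace is the inner product with the orthogonal projection,
  whose squared Frobenius norm is \<open>n - 1\<close>.\<close>

lemma trace_sq_le_of_orthogonal:
  fixes v :: "'a::euclidean_space \<Rightarrow> 'a"
  assumes k: "k \<noteq> 0" and v: "\<And>b. b \<in> Basis \<Longrightarrow> v b \<bullet> k = 0"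
  shows "(\<Sum>b\<in>Basis. v b \<bullet> b)\<^sup>2 \<le> (real DIM('a) - 1) * (\<Sum>b\<in>Basis. (norm (v b))\<^sup>2)"
proof -
  define p where "p b = b - ((b \<bullet> k) / (k \<bullet> k)) *\<^sub>R k" for b
  have kk: "k \<bullet> k \<noteq> 0"
    using k by simp
  have vp: "v b \<bullet> b = v b \<bullet> p b" if "b \<in> Basis" for b
    using v[OF that] by (simp add: p_def inner_diff_right)
  have pp: "(norm (p b))\<^sup>2 = 1 - (k \<bullet> b)\<^sup>2 / (k \<bullet> k)" if "b \<in> Basis" for b
    using that kk unfolding power2_norm_eq_inner p_def
    by (simp add: inner_diff inner_Basis inner_commute field_simps power2_eq_square)
  have "(\<Sum>b\<in>Basis. (norm (p b))\<^sup>2) = real DIM('a) - (\<Sum>b\<in>Basis. (k \<bullet> b)\<^sup>2) / (k \<bullet> k)"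
    by (simp add: pp sum_subtractf sum_divide_distrib)
  also have "(\<Sum>b\<in>Basis. (k \<bullet> b)\<^sup>2) = k \<bullet> k"
    unfolding euclidean_inner[of k k] by (simp add: power2_eq_square)
  finally have sp: "(\<Sum>b\<in>Basis. (norm (p b))\<^sup>2) = real DIM('a) - 1"
    using kk by simp
  have "\<bar>\<Sum>b\<in>Basis. v b \<bullet> b\<bar> \<le> (\<Sum>b\<in>Basis. \<bar>v b \<bullet> b\<bar>)"
    by (rule sum_abs)
  also have "\<dots> \<le> (\<Sum>b\<in>Basis. norm (v b) * norm (p b))"
    by (intro sum_mono) (simp add: vp Cauchy_Schwarz_ineq2)
  finally have "(\<Sum>b\<in>Basis. v b \<bullet> b)\<^sup>2 \<le> (\<Sum>b\<in>Basis. norm (v b) * norm (p b))\<^sup>2"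
    by (rule power2_le_iff_abs_le[THEN iffD2, rotated]) (intro sum_nonneg mult_nonneg_nonneg norm_ge_zero)
  also have "\<dots> \<le> (\<Sum>b\<in>Basis. (norm (v b))\<^sup>2) * (\<Sum>b\<in>Basis. (norm (p b))\<^sup>2)"
    by (rule Cauchy_Schwarz_ineq_sum)
  finally show ?thesis
    by (simp add: sp mult.commute)
qed

text \<open>Differentiate \<open>sin (2 * pi * (k \<bullet> x) + \<theta>) * (F x \<bullet>
  c)\<close> along \<open>c\<close> and sum over \<open>c\<close>: the divergence term drops out,
  and what remains is \<open>2 * pi\<close> times the integrand paired with \<open>k\<close>. The
  phase \<open>\<theta>\<close> treats cosine and sine at once.\<close>

lemma integral_cos_div_free:
  fixes F :: "'a::euclidean_space \<Rightarrow> 'a"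
  assumes der: "\<And>x. (F has_derivative F' x) (at x)"
    and cont: "\<And>c. c \<in> Basis \<Longrightarrow> continuous_on UNIV (\<lambda>x. F' x c)"
    and div: "\<And>x. (\<Sum>c\<in>Basis. F' x c \<bullet> c) = 0"
    and per: "torus_periodic F" and k: "k \<in> int_lattice"
  shows "integral torus_cell (\<lambda>x. cos (2 * pi * (k \<bullet> x) + \<theta>) *\<^sub>R F x) \<bullet> k = 0"
proof -
  have F: "continuous_on A F" for A
    using der has_derivative_continuous by (intro continuous_at_imp_continuous_on) blast
  note [continuous_intros] = F continuous_on_subset[OF cont subset_UNIV]
  define G' where "G' c x y = (cos (2 * pi * (k \<bullet> x) + \<theta>) * (2 * pi * (k \<bullet> y))) * (F x \<bullet> c)
      + sin (2 * pi * (k \<bullet> x) + \<theta>) * (F' x y \<bullet> c)" for c x y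
  have zero: "integral torus_cell (\<lambda>x. G' c x c) = 0" if c: "c \<in> Basis" for c
  proof (rule integral_periodic_derivative[where f = "\<lambda>x. sin (2 * pi * (k \<bullet> x) + \<theta>) * (F x \<bullet> c)" and f' = "G' c" and b = c])
    show "((\<lambda>x. sin (2 * pi * (k \<bullet> x) + \<theta>) * (F x \<bullet> c)) has_derivative G' c x) (at x)" for x
      unfolding G'_def by (auto intro!: derivative_eq_intros der simp: algebra_simps)
    show "continuous_on UNIV (\<lambda>x. G' c x c)"
      unfolding G'_def using c by (intro continuous_intros)
    obtain n :: int where n: "k \<bullet> c = n"
      using k c by (auto simp: int_lattice_def elim: Ints_cases)
    show "sin (2 * pi * (k \<bullet> (x + c)) + \<theta>) * (F (x + c) \<bullet> c) = sin (2 * pi * (k \<bullet> x) + \<theta>) * (F x \<bullet> c)" for x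
    proof -
      have "2 * pi * (k \<bullet> (x + c)) + \<theta> = (2 * pi * (k \<bullet> x) + \<theta>) + 2 * pi * n"
        by (simp add: inner_add_right n algebra_simps)
      then have "sin (2 * pi * (k \<bullet> (x + c)) + \<theta>) = sin (2 * pi * (k \<bullet> x) + \<theta>)"
        using sin_cos_eq_iff by blast
      moreover have "F (x + c) = F x"
        using per c by (simp add: torus_periodic_def)
      ultimately show ?thesis by simp
    qed
  qed (use c in simp_all)
  have "0 = (\<Sum>c\<in>Basis. integral torus_cell (\<lambda>x. G' c x c))"
    by (simp add: zero)
  also have "\<dots> = integral torus_cell (\<lambda>x. \<Sum>c\<in>Basis. G' c x c)"
    unfolding G'_def by (intro integral_sum[symmetric] integrable_continuous continuous_intros) auto
  also have "(\<lambda>x. \<Sum>c\<in>Basis. G' c x c) = (\<lambda>x. 2 * pi * ((cos (2 * pi * (k \<bullet> x) + \<theta>) *\<^sub>R F x) \<bullet> k))"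
  proof
    fix x
    have "(\<Sum>c\<in>Basis. G' c x c) = cos (2 * pi * (k \<bullet> x) + \<theta>) * 2 * pi * (\<Sum>c\<in>Basis. (F x \<bullet> c) * (k \<bullet> c))
        + sin (2 * pi * (k \<bullet> x) + \<theta>) * (\<Sum>c\<in>Basis. F' x c \<bullet> c)"
      by (simp add: G'_def sum.distrib sum_distrib_left sum_distrib_right mult_ac)
    then show "(\<Sum>c\<in>Basis. G' c x c) = 2 * pi * ((cos (2 * pi * (k \<bullet> x) + \<theta>) *\<^sub>R F x) \<bullet> k)"
      by (simp add: div euclidean_inner[of "F x" k])
  qed
  also have "integral torus_cell \<dots> = 2 * pi * (integral torus_cell (\<lambda>x. cos (2 * pi * (k \<bullet> x) + \<theta>) *\<^sub>R F x) \<bullet> k)"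
    using integral_linear[OF _ bounded_linear_inner_left, 
        of "\<lambda>x. cos (2 * pi * (k \<bullet> x) + \<theta>) *\<^sub>R F x" torus_cell k]
    by (simp add: o_def integrable_continuous continuous_intros)
  finally show ?thesis
    by simp
qed

text \<open>Real cosine and sine integrals are kept as vectors, so that their orthogonality to
  \<open>k\<close> can be used in the real inner product.\<close>

lemma fourier_coeff_inner:
  fixes F :: "'a::euclidean_space \<Rightarrow> 'b::euclidean_space"
  assumes F: "continuous_on UNIV F"
  shows "fourier_coeff (\<lambda>x. complex_of_real (F x \<bullet> b)) k =
    Complex (integral torus_cell (\<lambda>x. cos (2 * pi * (k \<bullet> x)) *\<^sub>R F x) \<bullet> b)
            (- (integral torus_cell (\<lambda>x. sin (2 * pi * (k \<bullet> x)) *\<^sub>R F x) \<bullet> b))"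
proof -
  note [continuous_intros] = continuous_on_subset[OF F subset_UNIV]
  have int: "(\<lambda>x. complex_of_real (F x \<bullet> b) * cnj (character k x)) integrable_on torus_cell"
    by (intro integrable_continuous continuous_intros)
  have "Re (fourier_coeff (\<lambda>x. complex_of_real (F x \<bullet> b)) k) =
      integral torus_cell (\<lambda>x. (cos (2 * pi * (k \<bullet> x)) *\<^sub>R F x) \<bullet> b)"
    using integral_linear[OF int bounded_linear_Re]
    by (simp add: fourier_coeff_def o_def character_def mult.commute)
  also have "\<dots> = integral torus_cell (\<lambda>x. cos (2 * pi * (k \<bullet> x)) *\<^sub>R F x) \<bullet> b"
    using integral_linear[OF _ bounded_linear_inner_left, of "\<lambda>x. cos (2 * pi * (k \<bullet> x)) *\<^sub>R F x" torus_cell b]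
    by (simp add: o_def integrable_continuous continuous_intros)
  finally have 1: "Re (fourier_coeff (\<lambda>x. complex_of_real (F x \<bullet> b)) k) = \<dots>" .
  have "Im (fourier_coeff (\<lambda>x. complex_of_real (F x \<bullet> b)) k) =
      integral torus_cell (\<lambda>x. - ((sin (2 * pi * (k \<bullet> x)) *\<^sub>R F x) \<bullet> b))"
    using integral_linear[OF int bounded_linear_Im]
    by (simp add: fourier_coeff_def o_def character_def mult.commute)
  also have "\<dots> = - (integral torus_cell (\<lambda>x. sin (2 * pi * (k \<bullet> x)) *\<^sub>R F x) \<bullet> b)"
    using integral_linear[OF _ bounded_linear_inner_left, of "\<lambda>x. sin (2 * pi * (k \<bullet> x)) *\<^sub>R F x" torus_cell b]
    by (simp add: o_def integrable_continuous continuous_intros)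
  finally show ?thesis
    using 1 by (simp add: complex_eq_iff)
qed

lemma power2_norm_eq_sum_Basis:
  fixes w :: "'a::euclidean_space"
  shows "(norm w)\<^sup>2 = (\<Sum>c\<in>Basis. (w \<bullet> c)\<^sup>2)"
  unfolding power2_norm_eq_inner euclidean_inner[of w w] by (simp add: power2_eq_square)

lemma sum_norm_fourier_coeff_inner:
  fixes F :: "'a::euclidean_space \<Rightarrow> 'b::euclidean_space"
  assumes F: "continuous_on UNIV F"
  shows "(\<Sum>c\<in>Basis. (norm (fourier_coeff (\<lambda>x. complex_of_real (F x \<bullet> c)) k))\<^sup>2) =
    (norm (integral torus_cell (\<lambda>x. cos (2 * pi * (k \<bullet> x)) *\<^sub>R F x)))\<^sup>2
    + (norm (integral torus_cell (\<lambda>x. sin (2 * pi * (k \<bullet> x)) *\<^sub>R F x)))\<^sup>2"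
  by (simp add: fourier_coeff_inner[OF F] cmod_power2 sum.distrib power2_norm_eq_sum_Basis)

text \<open>At each nonzero frequency \<open>k\<close> the cosine and sine coefficients of all
  fields \<open>F b\<close> are orthogonal to \<open>k\<close>, so
  \<open>trace_sq_le_of_orthogonal\<close> applies. Parseval up to \<open>e\<close> bounds the trace
  by its coefficients, and Bessel leads from the coefficients of the fields back to their
  integrals.\<close>

lemma div_free_trace_inequality:
  fixes F :: "'a::euclidean_space \<Rightarrow> 'a \<Rightarrow> 'a"
  assumes der: "\<And>b x. b \<in> Basis \<Longrightarrow> (F b has_derivative F' b x) (at x)"
    and cont: "\<And>b c. b \<in> Basis \<Longrightarrow> c \<in> Basis \<Longrightarrow> continuous_on UNIV (\<lambda>x. F' b x c)"
    and div: "\<And>b x. b \<in> Basis \<Longrightarrow> (\<Sum>c\<in>Basis. F' b x c \<bullet> c) = 0"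
    and per: "\<And>b. b \<in> Basis \<Longrightarrow> torus_periodic (F b)"
    and mean: "\<And>b. b \<in> Basis \<Longrightarrow> integral torus_cell (F b) = 0"
  shows "integral torus_cell (\<lambda>x. (\<Sum>b\<in>Basis. F b x \<bullet> b)\<^sup>2)
    \<le> (real DIM('a) - 1) * (\<Sum>b\<in>Basis. integral torus_cell (\<lambda>x. (norm (F b x))\<^sup>2))"
proof (rule field_le_epsilon)
  fix e :: real assume e: "e > 0"
  have F: "continuous_on A (F b)" if "b \<in> Basis" for A b
    using der[OF that] has_derivative_continuous by (intro continuous_at_imp_continuous_on) blast
  define s where "s x = (\<Sum>b\<in>Basis. F b x \<bullet> b)" for x
  define C where "C b k = integral torus_cell (\<lambda>x. cos (2 * pi * (k \<bullet> x)) *\<^sub>R F b x)" for b k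
  define S where "S b k = integral torus_cell (\<lambda>x. sin (2 * pi * (k \<bullet> x)) *\<^sub>R F b x)" for b k
  have "continuous_on UNIV s"
    unfolding s_def by (intro continuous_intros F)
  moreover have "torus_periodic s"
    using per by (simp add: s_def torus_periodic_def)
  ultimately obtain K where K: "finite K" "K \<subseteq> int_lattice" and
    le: "integral torus_cell (\<lambda>x. (s x)\<^sup>2) \<le> (\<Sum>k\<in>K. (norm (fourier_coeff (\<lambda>x. complex_of_real (s x)) k))\<^sup>2) + e"
    using e by (rule parseval_approx)
  have CS: "fourier_coeff (\<lambda>x. complex_of_real (F b x \<bullet> c)) k = Complex (C b k \<bullet> c) (- (S b k \<bullet> c))"
    if "b \<in> Basis" for b c k
    unfolding C_def S_def by (rule fourier_coeff_inner[OF F[OF that]])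
  have sk: "fourier_coeff (\<lambda>x. complex_of_real (s x)) k =
      Complex (\<Sum>b\<in>Basis. C b k \<bullet> b) (- (\<Sum>b\<in>Basis. S b k \<bullet> b))" for k
  proof -
    have "fourier_coeff (\<lambda>x. complex_of_real (s x)) k =
        integral torus_cell (\<lambda>x. \<Sum>b\<in>Basis. complex_of_real (F b x \<bullet> b) * cnj (character k x))"
      by (simp add: fourier_coeff_def s_def sum_distrib_right)
    also have "\<dots> = (\<Sum>b\<in>Basis. fourier_coeff (\<lambda>x. complex_of_real (F b x \<bullet> b)) k)"
      unfolding fourier_coeff_def
      by (intro integral_sum integrable_continuous continuous_intros F) auto
    also have "\<dots> = (\<Sum>b\<in>Basis. Complex (C b k \<bullet> b) (- (S b k \<bullet> b)))"
      by (simp add: CS)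
    finally show ?thesis
      by (simp add: complex_eq_iff sum_negf)
  qed
  \<comment> \<open>The phase \<open>- pi / 2\<close> turns the cosine into the sine.\<close>
  have "C b k \<bullet> k = 0" "S b k \<bullet> k = 0" if "b \<in> Basis" "k \<in> int_lattice" for b k
    using integral_cos_div_free[OF der cont div per, OF that(1,1) _ that(1,1,2), of 0]
      integral_cos_div_free[OF der cont div per, OF that(1,1) _ that(1,1,2), of "- pi / 2"] that(1)
    by (simp_all add: C_def S_def cos_diff)
  \<comment> \<open>Orthogonality to \<open>k\<close> is void at \<open>k = 0\<close>; there the
    zero mean removes the cosine coefficient, and the sine is identically zero.\<close>
  moreover have "C b 0 = 0" "S b 0 = 0" if "b \<in> Basis" for b
    using mean[OF that] by (simp_all add: C_def S_def)
  ultimately have CS_le: "(\<Sum>b\<in>Basis. C b k \<bullet> b)\<^sup>2 \<le> (real DIM('a) - 1) * (\<Sum>b\<in>Basis. (norm (C b k))\<^sup>2)"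
    "(\<Sum>b\<in>Basis. S b k \<bullet> b)\<^sup>2 \<le> (real DIM('a) - 1) * (\<Sum>b\<in>Basis. (norm (S b k))\<^sup>2)"
    if "k \<in> int_lattice" for k
    using that by (cases "k = 0"; force intro: trace_sq_le_of_orthogonal)+
  have "(\<Sum>k\<in>K. (norm (fourier_coeff (\<lambda>x. complex_of_real (s x)) k))\<^sup>2)
      \<le> (\<Sum>k\<in>K. (real DIM('a) - 1) * (\<Sum>b\<in>Basis. (norm (C b k))\<^sup>2 + (norm (S b k))\<^sup>2))"
  proof (rule sum_mono)
    fix k assume "k \<in> K"
    then show "(norm (fourier_coeff (\<lambda>x. complex_of_real (s x)) k))\<^sup>2
        \<le> (real DIM('a) - 1) * (\<Sum>b\<in>Basis. (norm (C b k))\<^sup>2 + (norm (S b k))\<^sup>2)"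
      using CS_le[of k] K by (auto simp: sk cmod_power2 sum.distrib ring_distribs)
  qed
  also have "\<dots> = (real DIM('a) - 1) * (\<Sum>b\<in>Basis. \<Sum>k\<in>K. (norm (C b k))\<^sup>2 + (norm (S b k))\<^sup>2)"
    by (subst sum.swap) (simp add: sum_distrib_left)
  also have "\<dots> \<le> (real DIM('a) - 1) * (\<Sum>b\<in>Basis. integral torus_cell (\<lambda>x. (norm (F b x))\<^sup>2))"
  proof (intro mult_left_mono sum_mono)
    fix b :: 'a assume b: "b \<in> Basis"
    have "(\<Sum>k\<in>K. (norm (C b k))\<^sup>2 + (norm (S b k))\<^sup>2)
        = (\<Sum>c\<in>Basis. \<Sum>k\<in>K. (norm (fourier_coeff (\<lambda>x. complex_of_real (F b x \<bullet> c)) k))\<^sup>2)"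
      unfolding C_def S_def by (subst sum.swap) (simp add: sum_norm_fourier_coeff_inner[OF F[OF b]])
    also have "\<dots> \<le> (\<Sum>c\<in>Basis. integral torus_cell (\<lambda>x. (norm (complex_of_real (F b x \<bullet> c)))\<^sup>2))"
      by (intro sum_mono bessel_inequality K continuous_intros F b)
    also have "\<dots> = integral torus_cell (\<lambda>x. \<Sum>c\<in>Basis. (F b x \<bullet> c)\<^sup>2)"
      by (subst integral_sum) (auto intro!: integrable_continuous continuous_intros F b)
    also have "(\<lambda>x. \<Sum>c\<in>Basis. (F b x \<bullet> c)\<^sup>2) = (\<lambda>x. (norm (F b x))\<^sup>2)"
      by (simp add: power2_norm_eq_sum_Basis)
    finally show "(\<Sum>k\<in>K. (norm (C b k))\<^sup>2 + (norm (S b k))\<^sup>2) \<le> integral torus_cell (\<lambda>x. (norm (F b x))\<^sup>2)" .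
  qed (simp add: Suc_leI)
  finally show "integral torus_cell (\<lambda>x. (\<Sum>b\<in>Basis. F b x \<bullet> b)\<^sup>2)
    \<le> (real DIM('a) - 1) * (\<Sum>b\<in>Basis. integral torus_cell (\<lambda>x. (norm (F b x))\<^sup>2)) + e"
    using le by (simp add: s_def)
qed

section \<open>A quasiconvex quadratic form\<close>

text \<open>Passage from the Lebesgue integral of the definitions to the gauge integral in which the
  Fourier arguments are carried out.\<close>

lemma torus_integral_eq_integral:
  fixes f :: "'a::euclidean_space \<Rightarrow> 'b::euclidean_space"
  assumes "continuous_on UNIV f"
  shows "torus_integral f = integral torus_cell f"
  unfolding torus_integral_def
  by (intro set_lebesgue_integral_eq_integral absolutely_integrable_continuous continuous_on_subset[OF assms]) simp

lemma C_inf_D: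
  assumes "C_inf f"
  shows C_inf_has_derivative: "(f has_derivative frechet_derivative f (at x)) (at x)"
    and C_inf_continuous_derivative: "b \<in> Basis \<Longrightarrow> continuous_on A (\<lambda>x. frechet_derivative f (at x) b)"
    and C_inf_continuous: "continuous_on A f"
proof -
  have "C_k 1 f"
    using assms unfolding C_inf_def by blast
  then have diff: "f differentiable (at x)"
      and "\<forall>b\<in>Basis. continuous_on UNIV (\<lambda>x. frechet_derivative f (at x) b)" for x
    by auto
  then show "b \<in> Basis \<Longrightarrow> continuous_on A (\<lambda>x. frechet_derivative f (at x) b)"
    by (meson continuous_on_subset subset_UNIV)
  show "(f has_derivative frechet_derivative f (at x)) (at x)"
    using diff frechet_derivative_works by blast
  show "continuous_on A f"
    by (intro continuous_at_imp_continuous_on ballI differentiable_imp_continuous_within diff)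
qed

section \<open>Euler states as matrices with divergence-free rows\<close>

lemma sum_Basis_spacetime:
  "(\<Sum>b\<in>(Basis :: (real \<times> (real ^ 'n)) set). f b) = f (1, 0) + (\<Sum>i\<in>UNIV. f (0, axis i 1))"
proof -
  have eq: "(Basis :: (real \<times> (real ^ 'n)) set) = insert (1, 0) (range (\<lambda>i. (0, axis i 1)))"
    by (auto simp: Basis_prod_def Basis_vec_def)
  have inj: "inj (\<lambda>i::'n. (0::real, axis i (1::real)))"
    by (auto simp: inj_on_def axis_eq_axis)
  show ?thesis
    unfolding eq by (subst sum.insert) (auto simp: sum.reindex[OF inj])
qed

lemma sum_mult_axis: "(\<Sum>j\<in>UNIV. g j * (axis i 1 $ j)) = (g i :: real)"
  by (simp add: axis_def if_distrib cong: if_cong)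

definition mass_row :: "('d::finite) state \<Rightarrow> real \<times> (real ^ 'd)" where
  "mass_row z = (fst z, fst (snd z))"

text \<open>Adding \<open>Q\<close> to the diagonal entry absorbs the pressure gradient into the
  divergence of the row.\<close>

definition momentum_row :: "'d \<Rightarrow> ('d::finite) state \<Rightarrow> real \<times> (real ^ 'd)" where
  "momentum_row i z = (fst (snd z) $ i, fst (snd (snd z)) $ i + snd (snd (snd z)) *\<^sub>R axis i 1)"

lemma bounded_linear_rows: "bounded_linear mass_row" "bounded_linear (momentum_row i)"
  unfolding linear_conv_bounded_linear[symmetric]
  by (auto intro!: linearI simp: mass_row_def momentum_row_def algebra_simps)

text \<open>The components of the Euler operator are the space-time divergences of these
  rows.\<close>

lemma euler_op_rows:
  fixes \<phi> :: "real \<times> (real ^ 'd) \<Rightarrow> ('d::finite) state"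
  assumes \<phi>: "(\<phi> has_derivative D) (at y)" and op: "euler_op \<phi> y = (0, 0)"
  shows "(\<Sum>c\<in>Basis. mass_row (D c) \<bullet> c) = 0" "(\<Sum>c\<in>Basis. momentum_row i (D c) \<bullet> c) = 0"
proof -
  have D: "frechet_derivative (\<lambda>y. fst (\<phi> y)) (at y) = (\<lambda>h. fst (D h))"
    "frechet_derivative (\<lambda>y. fst (snd (\<phi> y))) (at y) = (\<lambda>h. fst (snd (D h)))"
    "frechet_derivative (\<lambda>y. fst (snd (snd (\<phi> y)))) (at y) = (\<lambda>h. fst (snd (snd (D h))))"
    "frechet_derivative (\<lambda>y. snd (snd (snd (\<phi> y)))) (at y) = (\<lambda>h. snd (snd (snd (D h))))"
    by (rule frechet_derivative_at[symmetric], auto intro!: derivative_eq_intros \<phi>)+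
  have mass: "fst (D (1, 0)) + (\<Sum>j\<in>UNIV. fst (snd (D (0, axis j 1))) $ j) = 0"
   and mom: "fst (snd (D (1, 0))) + (\<chi> i. \<Sum>j\<in>UNIV. fst (snd (snd (D (0, axis j 1)))) $ i $ j)
      + (\<chi> i. snd (snd (snd (D (0, axis i 1))))) = 0"
    using op by (simp_all add: euler_op_def Let_def case_prod_beta d_t_def d_x_def div_x_def D)
  show "(\<Sum>c\<in>Basis. mass_row (D c) \<bullet> c) = 0"
    using mass by (simp add: sum_Basis_spacetime mass_row_def inner_axis)
  have "fst (snd (D (1, 0))) $ i + (\<Sum>j\<in>UNIV. fst (snd (snd (D (0, axis j 1)))) $ i $ j)
      + snd (snd (snd (D (0, axis i 1)))) = 0"
    using arg_cong[OF mom, of "\<lambda>v. v $ i"] by simp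
  then show "(\<Sum>c\<in>Basis. momentum_row i (D c) \<bullet> c) = 0"
    by (simp add: sum_Basis_spacetime momentum_row_def inner_axis sum.distrib sum_mult_axis)
qed

text \<open>\<open>twisted_row b z\<close> is column \<open>b\<close> of \<open>X D\<^sup>-\<^sup>1\<close>, where \<open>X\<close> is the symmetric matrix with rows \<open>(\<rho>, m)\<close>,
  \<open>(m, M + Q)\<close>, and \<open>D\<close> is its value at \<open>\<rho> = 0, m = e\<^sub>1, M = 0, Q = 1\<close>: that is
  \<open>D = ((0,1,0), (1,1,0), (0,0,1))\<close> and \<open>D\<^sup>-\<^sup>1 = ((-1,1,0), (1,0,0), (0,0,1))\<close>.\<close>

definition twisted_row :: "real \<times> (real ^ 2) \<Rightarrow> 2 state \<Rightarrow> real \<times> (real ^ 2)" where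
  "twisted_row b z =
     (if b = (1, 0) then momentum_row 1 z - mass_row z
      else if b = (0, axis 1 1) then mass_row z else momentum_row 2 z)"

definition twisted_trace :: "2 state \<Rightarrow> real" where
  "twisted_trace z = (\<Sum>b\<in>Basis. twisted_row b z \<bullet> b)"

text \<open>The quadratic form \<open>2 |Y|\<^sup>2 - (tr Y)\<^sup>2\<close> with \<open>Y = X D\<^sup>-\<^sup>1\<close> is nonnegative where \<open>Y\<close> is singular, that is, on the
  wave cone, and negative at \<open>Y = 1\<close>.\<close>

definition twisted_form :: "2 state \<Rightarrow> real" where
  "twisted_form z = 2 * (\<Sum>b\<in>Basis. (norm (twisted_row b z))\<^sup>2) - (twisted_trace z)\<^sup>2"

text \<open>The cross term of the quadratic form, normalised so that
  \<open>twisted_polar z z = 2 * twisted_form z\<close>.\<close>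

definition twisted_polar :: "2 state \<Rightarrow> 2 state \<Rightarrow> real" where
  "twisted_polar z w =
     4 * (\<Sum>b\<in>Basis. twisted_row b z \<bullet> twisted_row b w) - 2 * (twisted_trace z * twisted_trace w)"

lemma bounded_linear_twisted_row: "bounded_linear (twisted_row b)"
  unfolding twisted_row_def
  by (cases "b = (1, 0)"; cases "b = (0, axis 1 1)") (simp_all add: bounded_linear_rows bounded_linear_sub)

lemma bounded_linear_twisted_trace: "bounded_linear twisted_trace"
  unfolding twisted_trace_def
  by (intro bounded_linear_sum bounded_linear_compose[OF bounded_linear_inner_left] bounded_linear_twisted_row)

lemma bounded_linear_twisted_polar: "bounded_linear (twisted_polar z)"
  unfolding twisted_polar_def
  by (intro bounded_linear_sub bounded_linear_sum bounded_linear_const_mult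
      bounded_linear_compose[OF bounded_linear_inner_right]
      bounded_linear_twisted_row bounded_linear_twisted_trace)

lemma twisted_form_add: "twisted_form (z + w) = twisted_form z + twisted_polar z w + twisted_form w"
proof -
  interpret Y: bounded_linear "twisted_row b" for b by (rule bounded_linear_twisted_row)
  interpret t: bounded_linear twisted_trace by (rule bounded_linear_twisted_trace)
  show ?thesis
    by (simp add: twisted_form_def twisted_polar_def Y.add t.add power2_norm_eq_inner inner_add
        inner_commute power2_sum sum.distrib algebra_simps)
      (simp add: sum_distrib_left)
qed

lemma twisted_form_minus: "twisted_form (- w) = twisted_form w"
  by (simp add: twisted_form_def linear_simps(4)[OF bounded_linear_twisted_row]
      linear_simps(4)[OF bounded_linear_twisted_trace])

text \<open>The cross terms cancel. With \<open>z\<close> a barycentre and \<open>w\<close> half a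
  difference, this computes the average of the form over two states.\<close>

lemma twisted_form_parallelogram:
  "twisted_form (z + w) + twisted_form (z - w) = 2 * (twisted_form z + twisted_form w)"
  using twisted_form_add[of z w] twisted_form_add[of z "- w"]
  by (simp add: linear_simps(4)[OF bounded_linear_twisted_polar] twisted_form_minus)

text \<open>Here \<open>Y\<close> is the 3 by 3 identity, so the value is
  \<open>2 * 3 - 3\<^sup>2\<close>.\<close>

lemma twisted_form_unit: "twisted_form (0, axis 1 1, 0, 1) = -3"
  by (simp add: twisted_form_def twisted_trace_def twisted_row_def sum_Basis_spacetime sum_2
      mass_row_def momentum_row_def power2_norm_eq_inner inner_axis axis_eq_axis inner_vec_def) (simp add: axis_def)

lemma continuous_on_twisted_form [continuous_intros]:
  "continuous_on A g \<Longrightarrow> continuous_on A (\<lambda>x. twisted_form (g x))"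
  unfolding twisted_form_def
  by (intro continuous_intros bounded_linear.continuous_on[OF bounded_linear_twisted_row]
      bounded_linear.continuous_on[OF bounded_linear_twisted_trace])

text \<open>Space-time has dimension 3, so the factor dimension minus one in
  \<open>div_free_trace_inequality\<close> is exactly the coefficient 2 in
  \<open>twisted_form\<close>.\<close>

lemma integral_twisted_form_nonneg:
  fixes \<phi> :: "real \<times> (real ^ 2) \<Rightarrow> 2 state"
  assumes C: "C_inf \<phi>" and per: "torus_periodic \<phi>" and op: "\<And>y. euler_op \<phi> y = (0, 0)"
    and mean: "integral torus_cell \<phi> = 0"
  shows "0 \<le> integral torus_cell (\<lambda>y. twisted_form (\<phi> y))"
proof -
  note cont [continuous_intros] = C_inf_continuous[OF C]
  have Y [continuous_intros]: "continuous_on A (\<lambda>y. twisted_row b (g y))" 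
    if "continuous_on A g" for A b and g :: "real \<times> (real ^ 2) \<Rightarrow> 2 state"
    using that by (rule bounded_linear.continuous_on[OF bounded_linear_twisted_row])
  have "integral torus_cell (\<lambda>y. (\<Sum>b\<in>Basis. twisted_row b (\<phi> y) \<bullet> b)\<^sup>2)
    \<le> (real DIM(real \<times> (real ^ 2)) - 1) * (\<Sum>b\<in>Basis. integral torus_cell (\<lambda>y. (norm (twisted_row b (\<phi> y)))\<^sup>2))"
  proof (rule div_free_trace_inequality)
    fix b c :: "real \<times> (real ^ 2)" and y
    show "((\<lambda>y. twisted_row b (\<phi> y)) has_derivative (\<lambda>h. twisted_row b (frechet_derivative \<phi> (at y) h))) (at y)"
      by (rule bounded_linear.has_derivative[OF bounded_linear_twisted_row C_inf_has_derivative[OF C]])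
    show "continuous_on UNIV (\<lambda>y. twisted_row b (frechet_derivative \<phi> (at y) c))" if "c \<in> Basis"
      using that by (intro continuous_intros C_inf_continuous_derivative[OF C])
    \<comment> \<open>Twisted rows are combinations of the mass and momentum rows with constant
      coefficients and so inherit zero divergence.\<close>
    show "(\<Sum>c\<in>Basis. twisted_row b (frechet_derivative \<phi> (at y) c) \<bullet> c) = 0"
      using euler_op_rows[OF C_inf_has_derivative[OF C] op]
      by (cases "b = (1, 0)"; cases "b = (0, axis 1 1)")
         (simp_all add: twisted_row_def inner_diff_left sum_subtractf)
    show "torus_periodic (\<lambda>y. twisted_row b (\<phi> y))"
      using per by (simp add: torus_periodic_def)
    have "integral torus_cell (twisted_row b \<circ> \<phi>) = twisted_row b (integral torus_cell \<phi>)"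
      by (intro integral_linear bounded_linear_twisted_row integrable_continuous cont)
    then show "integral torus_cell (\<lambda>y. twisted_row b (\<phi> y)) = 0"
      by (simp add: o_def mean linear_simps(3)[OF bounded_linear_twisted_row])
  qed
  moreover have "integral torus_cell (\<lambda>y. twisted_form (\<phi> y)) =
      2 * (\<Sum>b\<in>Basis. integral torus_cell (\<lambda>y. (norm (twisted_row b (\<phi> y)))\<^sup>2))
      - integral torus_cell (\<lambda>y. (\<Sum>b\<in>Basis. twisted_row b (\<phi> y) \<bullet> b)\<^sup>2)"
    unfolding twisted_form_def twisted_trace_def
    by (subst integral_diff integral_mult_right integral_sum; (intro integrable_continuous continuous_intros)?; simp)+
  ultimately show ?thesis
    by simp
qed

text \<open>In the expansion about \<open>z\<close> the linear term integrates to zero, because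
  admissible fields have mean zero, and the quadratic term has nonnegative integral.\<close>

lemma twisted_form_le_Q_envelope: "ereal (twisted_form z) \<le> Q_envelope twisted_form z"
  unfolding Q_envelope_def
proof (rule Inf_greatest, clarify)
  fix \<phi> :: "real \<times> (real ^ 2) \<Rightarrow> 2 state"
  assume C: "C_inf \<phi>" and per: "torus_periodic \<phi>" and op: "\<forall>y. euler_op \<phi> y = (0, 0)"
    and mean: "torus_integral \<phi> = 0"
  note cont [continuous_intros] = C_inf_continuous[OF C]
  have mean': "integral torus_cell \<phi> = 0"
    using mean by (simp add: torus_integral_eq_integral cont)
  have B: "continuous_on A (\<lambda>y. twisted_polar z (\<phi> y))" for A
    by (intro bounded_linear.continuous_on[OF bounded_linear_twisted_polar] cont)
  have "integral torus_cell (twisted_polar z \<circ> \<phi>) = twisted_polar z (integral torus_cell \<phi>)"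
    by (intro integral_linear bounded_linear_twisted_polar integrable_continuous cont)
  then have "integral torus_cell (\<lambda>y. twisted_polar z (\<phi> y)) = 0"
    by (simp add: o_def mean' linear_simps(3)[OF bounded_linear_twisted_polar])
  moreover have "torus_integral (\<lambda>y. twisted_form (z + \<phi> y)) = integral torus_cell (\<lambda>y. twisted_form (z + \<phi> y))"
    by (intro torus_integral_eq_integral continuous_intros)
  moreover have "\<dots> = twisted_form z + integral torus_cell (\<lambda>y. twisted_polar z (\<phi> y))
      + integral torus_cell (\<lambda>y. twisted_form (\<phi> y))"
    unfolding twisted_form_add
    by (subst integral_add; (intro integrable_continuous continuous_intros B)?; simp)+
  ultimately show "ereal (twisted_form z) \<le> ereal (torus_integral (\<lambda>y. twisted_form (z + \<phi> y)))"
    using integral_twisted_form_nonneg[OF C per op[rule_format] mean'] by simp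
qed

section \<open>The homogeneous solution\<close>

text \<open>A fair coin pushed forward. \<open>N\<close> supplies the sigma-algebra, so that one
  construction serves both \<open>borel\<close> and its restriction to
  \<open>state_space\<close>.\<close>

definition two_point :: "'a measure \<Rightarrow> 'a \<Rightarrow> 'a \<Rightarrow> 'a measure" where
  "two_point N a b = distr (measure_pmf (bernoulli_pmf (1/2))) N (\<lambda>c. if c then a else b)"

lemma sets_two_point [simp]: "sets (two_point N a b) = sets N"
  by (simp add: two_point_def)

context
  fixes N :: "'a measure" and a b :: 'a
  assumes ab: "a \<in> space N" "b \<in> space N"
begin

lemma measurable_choice: "(\<lambda>c. if c then a else b) \<in> measure_pmf p \<rightarrow>\<^sub>M N"
  using ab by auto

lemma prob_space_two_point: "prob_space (two_point N a b)"
  unfolding two_point_def by (intro prob_space.prob_space_distr prob_space_measure_pmf measurable_choice)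

lemma distr_two_point:
  assumes "h \<in> N \<rightarrow>\<^sub>M L"
  shows "distr (two_point N a b) L h = two_point L (h a) (h b)"
  unfolding two_point_def
  by (subst distr_distr[OF assms measurable_choice]) (simp add: o_def if_distrib)

lemma integrable_two_point:
  fixes h :: "'a \<Rightarrow> 'b::{banach, second_countable_topology}"
  assumes "h \<in> borel_measurable N"
  shows "integrable (two_point N a b) h"
  unfolding two_point_def
  by (subst integrable_distr_eq[OF measurable_choice assms]) (auto intro: integrable_measure_pmf_finite)

lemma integral_two_point:
  fixes h :: "'a \<Rightarrow> 'b::{banach, second_countable_topology}"
  assumes "h \<in> borel_measurable N"
  shows "integral\<^sup>L (two_point N a b) h = (1/2) *\<^sub>R (h a + h b)"
  unfolding two_point_def
  by (subst integral_distr[OF measurable_choice assms], subst integral_measure_pmf[of UNIV])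
     (auto simp: UNIV_bool algebra_simps)

lemma nn_integral_two_point:
  assumes "h \<in> borel_measurable N" "h a = h b"
  shows "nn_integral (two_point N a b) h = h a"
  unfolding two_point_def
  by (subst nn_integral_distr[OF measurable_choice])
     (simp_all add: assms if_distrib cong: if_cong)

end

section \<open>Integration over the space-time cell\<close>

lemma spacetime_borel: "spacetime T \<in> sets borel"
  by (intro borel_Times) auto

lemma spacetime_lebesgue: "spacetime T \<in> sets lebesgue"
  by (rule sets_completionI_sets) (simp add: spacetime_borel)

lemma spacetime_subset_cbox: "spacetime T \<subseteq> cbox (0, 0) (T, One)"
  by (auto simp: cbox_Pair_eq)

lemma set_integrable_spacetime:
  fixes g :: "real \<times> (real ^ 'd) \<Rightarrow> 'b::euclidean_space"
  assumes "continuous_on UNIV g"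
  shows "set_integrable lebesgue (spacetime T) g"
  by (rule set_integrable_subset[OF absolutely_integrable_continuous spacetime_lebesgue spacetime_subset_cbox])
     (rule continuous_on_subset[OF assms], simp)

text \<open>\<open>spacetime\<close> is open in time, whereas
  \<open>integral_periodic_derivative\<close> speaks of closed boxes; the faces at times
  \<open>0\<close> and \<open>T\<close> are null sets.\<close>

lemma integral_spacetime:
  fixes g :: "real \<times> (real ^ 'd) \<Rightarrow> 'b::euclidean_space"
  shows "integral (spacetime T) g = integral (cbox (0, 0) (T, One)) g"
proof (rule integral_subset_negligible[OF spacetime_subset_cbox])
  have "negligible ({z :: real \<times> (real ^ 'd). z \<bullet> (1, 0) = 0} \<union> {z. z \<bullet> (1, 0) = T})"
    by (intro negligible_Un negligible_standard_hyperplane) (auto simp: Basis_prod_def)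
  then show "negligible (cbox (0, 0) (T, One) - (spacetime T :: (real \<times> (real ^ 'd)) set))"
    by (rule negligible_subset) (auto simp: cbox_Pair_eq)
qed

lemma emeasure_spacetime_pos:
  assumes "T > 0"
  shows "emeasure lebesgue (spacetime T :: (real \<times> (real ^ 'd)) set) > 0"
proof -
  have "box (0, 0) (T, One :: real ^ 'd) \<noteq> {}"
    using assms by (auto simp: box_ne_empty Basis_prod_def)
  moreover have "box (0, 0) (T, One :: real ^ 'd) \<subseteq> spacetime T"
    by (auto simp: mem_box Basis_prod_def ball_Un less_imp_le)
  ultimately have "\<not> negligible (spacetime T :: (real \<times> (real ^ 'd)) set)"
    using open_not_negligible[OF open_box] negligible_subset by blast
  then show ?thesis
    using spacetime_lebesgue negligible_iff_emeasure0 by (metis not_gr_zero)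
qed

text \<open>Half the difference of the two lifts is the state \<open>(0, e\<^sub>1, 0, 1)\<close>, at which \<open>twisted_form\<close> is negative.\<close>

definition euler_pair :: "((real ^ 2) \<times> real) measure" where
  "euler_pair = two_point borel (axis 1 1, 1) (- axis 1 1, -1)"

lemma integral_euler_pair:
  fixes h :: "(real ^ 2) \<times> real \<Rightarrow> 'b::{banach, second_countable_topology}"
  assumes "continuous_on UNIV h"
  shows "integral\<^sup>L euler_pair h = (1/2) *\<^sub>R (h (axis 1 1, 1) + h (- axis 1 1, -1))"
  unfolding euler_pair_def by (intro integral_two_point borel_measurable_continuous_onI assms) auto

text \<open>The test function is \<open>twisted_form\<close>: its envelope at the barycentre
  \<open>c\<close> is at least \<open>twisted_form c\<close>, while its average over the two lifts
  is \<open>twisted_form c - 3\<close>.\<close>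

lemma not_jensen_at_euler_pair: "\<not> jensen_at (lifted (\<lambda>_. euler_pair)) z"
proof
  define S where "S = restrict_space borel (state_space :: 2 state set)"
  define a where "a = lift (axis 1 1 :: real ^ 2, 1)"
  define b where "b = lift (- axis 1 1 :: real ^ 2, -1)"
  define c where "c = (1/2) *\<^sub>R (a + b)"
  define w :: "2 state" where "w = (0, axis 1 1, 0, 1)"
  have ab: "a \<in> space S" "b \<in> space S"
    by (simp_all add: S_def a_def b_def lift_in_state_space space_restrict_space)
  have meas: "h \<in> borel_measurable S" if "continuous_on UNIV h" 
    for h :: "2 state \<Rightarrow> 'b::{banach, second_countable_topology}"
    unfolding S_def by (intro measurable_restrict_space1 borel_measurable_continuous_onI that)
  have lifted: "lifted (\<lambda>_. euler_pair) z = two_point S a b"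
    unfolding lifted_def euler_pair_def S_def a_def b_def
    by (rule distr_two_point) (auto intro: lift_measurable)
  have cont: "continuous_on A twisted_form" for A
    using continuous_on_twisted_form[OF continuous_on_id] by simp
  assume "jensen_at (lifted (\<lambda>_. euler_pair)) z"
  then have "Q_envelope twisted_form (pairing (lifted (\<lambda>_. euler_pair)) (\<lambda>v. v) z)
      \<le> ereal (pairing (lifted (\<lambda>_. euler_pair)) twisted_form z)"
    unfolding jensen_at_def lifted using integrable_two_point[OF ab meas[OF cont]] cont by blast
  then have "Q_envelope twisted_form c \<le> ereal ((1/2) * (twisted_form a + twisted_form b))"
    unfolding pairing_def lifted
    by (simp add: integral_two_point[OF ab meas[OF cont]] integral_two_point[OF ab meas] c_def)
  then have "twisted_form c \<le> (1/2) * (twisted_form a + twisted_form b)"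
    using twisted_form_le_Q_envelope[of c] by (metis ereal_less_eq(3) order_trans)
  \<comment> \<open>Opposite velocities have the same \<open>outer u u\<close> and the same norm, so
    the lifts differ only in momentum and in the last component.\<close>
  moreover have "a = c + w" "b = c - w"
    by (auto simp: a_def b_def c_def w_def lift_def outer_def vec_eq_iff axis_def field_simps)
  ultimately show False
    using twisted_form_parallelogram[of c w] by (simp add: w_def twisted_form_unit)
qed

lemma inner_outer_axis: "J \<bullet> outer (axis i 1) (axis i 1) = J $ i $ i"
  by (simp add: inner_vec_def outer_def sum_mult_axis flip: mult.assoc)

text \<open>Mean velocity and mean pressure vanish, and the mean of \<open>outer u u\<close> is
  constant with a single nonzero entry. The weak momentum equation thus reduces to the integral of
  \<open>d_x 1 \<phi> z $ 1\<close>, which is zero by periodicity in space.\<close>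

lemma augmented_mv_solution_euler_pair: "augmented_mv_solution T (\<lambda>_. 0) (\<lambda>_. euler_pair)"
proof -
  have c1: "continuous_on UNIV (\<lambda>(u :: real ^ 2, P :: real). u)" 
    and c2: "continuous_on UNIV (\<lambda>(u :: real ^ 2, P :: real). P)"
    and c3: "continuous_on UNIV (\<lambda>(u :: real ^ 2, P :: real). outer u u)"
    unfolding case_prod_beta outer_def by (intro continuous_intros)+
  have p1: "pairing (\<lambda>_. euler_pair) (\<lambda>(u, P). u) z = 0"
    and p2: "pairing (\<lambda>_. euler_pair) (\<lambda>(u, P). P) z = 0"
    and p3: "pairing (\<lambda>_. euler_pair) (\<lambda>(u, P). outer u u) z = outer (axis 1 1) (axis 1 1)" 
      for z :: "real \<times> (real ^ 2)"
    unfolding pairing_def integral_euler_pair[OF c1] integral_euler_pair[OF c2] integral_euler_pair[OF c3]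
    by (auto simp: outer_def vec_eq_iff)
  have "L1_torus (\<lambda>_. 0 :: real ^ 2)"
    by (simp add: L1_torus_def torus_periodic_def set_integrable_def)
  moreover have "young_measure T (\<lambda>_. euler_pair)"
    by (auto simp: young_measure_def torus_periodic_def euler_pair_def prob_space_two_point)
  moreover have "(\<integral>\<^sup>+ (u, P). ennreal ((norm u)\<^sup>2) \<partial>euler_pair) \<le> ennreal 1"
  proof -
    have "(\<lambda>z :: (real ^ 2) \<times> real. (norm (fst z))\<^sup>2) \<in> borel_measurable borel"
      by (intro borel_measurable_continuous_onI continuous_intros)
    then show ?thesis
      unfolding euler_pair_def by (subst nn_integral_two_point) (auto simp: case_prod_beta)
  qed
  moreover have "integrable euler_pair (\<lambda>(u, P). P)"
    unfolding euler_pair_def by (intro integrable_two_point borel_measurable_continuous_onI c2) auto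
  moreover have "set_integrable lebesgue (spacetime T) (\<lambda>z. d_x 1 \<phi> z $ 1)"
    "set_lebesgue_integral lebesgue (spacetime T) (\<lambda>z. d_x 1 \<phi> z $ 1) = 0"
    if test: "test_field T \<phi>" for \<phi> :: "real \<times> (real ^ 2) \<Rightarrow> real ^ 2"
  proof -
    have \<phi>: "C_inf \<phi>" and per: "\<And>t. torus_periodic (\<lambda>x. \<phi> (t, x))"
      using test by (auto simp: test_field_def)
    have e: "(0, axis 1 1) \<in> (Basis :: (real \<times> (real ^ 2)) set)" "axis 1 1 \<in> (Basis :: (real ^ 2) set)"
      by (auto simp: Basis_prod_def)
    have cont: "continuous_on A (d_x 1 \<phi>)" for A
      unfolding d_x_def by (rule C_inf_continuous_derivative[OF \<phi> e(1)])
    show int: "set_integrable lebesgue (spacetime T) (\<lambda>z. d_x 1 \<phi> z $ 1)"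
      by (intro set_integrable_spacetime continuous_intros cont)
    \<comment> \<open>The box has side \<open>T\<close> in time but is one period long in the
      direction of differentiation.\<close>
    have "integral (cbox (0, 0) (T, One)) (d_x 1 \<phi>) = 0"
      unfolding d_x_def
    proof (rule integral_periodic_derivative[OF C_inf_has_derivative[OF \<phi>] C_inf_continuous_derivative[OF \<phi> e(1)] e(1)])
      fix z :: "real \<times> (real ^ 2)"
      show "\<phi> (z + (0, axis 1 1)) = \<phi> z"
        using per[of "fst z"] e(2) by (cases z) (simp add: torus_periodic_def)
    qed (use e(2) in simp)
    then show "set_lebesgue_integral lebesgue (spacetime T) (\<lambda>z. d_x 1 \<phi> z $ 1) = 0"
      by (simp add: set_lebesgue_integral_eq_integral(2)[OF int] integral_spacetime
          integral_component_eq_cart integrable_continuous cont)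
  qed
  ultimately show ?thesis
    unfolding augmented_mv_solution_def p1 p2 p3 inner_outer_axis
    by (auto simp: jacobian_x_def torus_integral_def set_lebesgue_integral_def intro!: exI[of _ 1])
qed

theorem corollary6p3:
  fixes T :: real
  assumes "T > 0"
  shows "\<exists>(u0 :: real ^ 2 \<Rightarrow> real ^ 2) (\<nu> :: real \<times> (real ^ 2) \<Rightarrow> ((real ^ 2) \<times> real) measure).
           Linf_torus u0 \<and> weakly_div_free u0 \<and> augmented_mv_solution T u0 \<nu> \<and>
           (\<exists>E \<in> sets lebesgue. E \<subseteq> spacetime T \<and> emeasure lebesgue E > 0 \<and>
              (\<forall>z\<in>E. \<not> jensen_at (lifted \<nu>) z))"
proof (intro exI conjI bexI)
  show "Linf_torus (\<lambda>_. 0 :: real ^ 2)"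
    by (auto simp: Linf_torus_def torus_periodic_def)
  show "weakly_div_free (\<lambda>_. 0 :: real ^ 2)"
    by (simp add: weakly_div_free_def torus_integral_def set_lebesgue_integral_def)
  show "augmented_mv_solution T (\<lambda>_. 0) (\<lambda>_. euler_pair)"
    by (rule augmented_mv_solution_euler_pair)
  show "emeasure lebesgue (spacetime T :: (real \<times> (real ^ 2)) set) > 0"
    using assms by (rule emeasure_spacetime_pos)
  \<comment> \<open>The measure is homogeneous, so the condition fails at every point and the whole
    cell serves as the set of positive measure.\<close>
  show "\<forall>z\<in>spacetime T. \<not> jensen_at (lifted (\<lambda>_. euler_pair)) z"
    using not_jensen_at_euler_pair by blast
qed (simp_all add: spacetime_lebesgue)

end
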